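(* Consider the parking model on $\mathbb{Z}^d$ with parameter $p$ and law $\mathbb{P}_p$. Let $\sigma$ be the time at which the parking spot at the origin is parked in by a car (where $\sigma=0$ if there is no such spot). Suppose $d=1$ and $p>1/2$. Then there exist constants $a,b>0$ such that \[ e^{-a\sqrt{t}}\ \le\ \mathbb{P}_p(\sigma>t)\ \le\ e^{-b\sqrt{t}}\qquad\text{for all } t\ge 1 . \]
   Context: Parking model on $\mathbb{Z}^d$ (here $d=1$) with parameter $p\in[0,1]$. The probability space is $\Omega=\left(\{-1,1\}\times(\mathbb{Z}^d)^{\mathbb{N}}\times[0,1]^{\mathbb{N}}\right)^{\mathbb{Z}^d}$ with a probability measure $\mathbb{P}_p$ under which the following are all independent, over all vertices $v\in\mathbb{Z}^d$ and over the three components at each $v$: (1) a variable equal to $1$ with probability $p$ (a car is initially at $v$) and $-1$ with probability $1-p$ (there is initially a vacant parking spot at $v$, and no car); (2) a discrete-time simple symmetric random walk path on $\mathbb{Z}^d$ started at $v$ (each step is to a uniformly chosen nearest neighbor), which is the path followed by the car starting at $v$ (if any) as long as it is unparked; (3) a sequence $(U^{(v)}_t)_t$ of i.i.d. uniform $[0,1]$ random variables used to break ties. Dynamics: at time $0$ all cars are unparked. At each time $t=1,2,\dots$, every car that is unparked at time $t-1$ simultaneously moves to the time-$t$ position of its random walk path. If at time $t$ at least one such car arrives at a vertex with a vacant parking spot, then exactly one of the arriving cars parks there at time $t$ (the one with the largest tie-breaking uniform variable of index $t$), and stays there forever; that spot is occupied from then on. Unparked cars arriving at any other vertex (an occupied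 spot, or a vertex that initially held a car and hence has no parking spot), and arriving cars that lose the tie-break, do not park and continue moving at the next time step. If there is a parking spot at the origin that is never parked in, then $\sigma=\infty$.
   Formalization: The formal theorem assumes 1/2 < p < 1; at p = 1 there is almost surely no parking spot at the origin, so σ = 0, P_p(σ > t) = 0 and the stated lower bound fails. *)

theory Defs
  imports "HOL-Probability.Probability" "HOL-Library.Extended_Nat"
begin

text \<open>
  The parking model on the integers. An outcome assigns to each vertex \<open>v\<close> a triple consisting of
  the initial content of \<open>v\<close> (\<open>1\<close>: a car, \<open>-1\<close>: a vacant parking spot), the trajectory of the
  car that starts at \<open>v\<close> (if any), and its sequence of tie-breaking variables.
\<close>

type_synonym outcome = "int \<Rightarrow> int \<times> (nat \<Rightarrow> int) \<times> (nat \<Rightarrow> real)"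

definition initial_law :: "real \<Rightarrow> int measure" where
  "initial_law p = measure_pmf (map_pmf (\<lambda>c. if c then 1 else -1) (bernoulli_pmf p))"

definition walk_law :: "int \<Rightarrow> (nat \<Rightarrow> int) measure" where
  "walk_law v =
     distr (\<Pi>\<^sub>M i\<in>(UNIV :: nat set). measure_pmf (pmf_of_set {-1, 1 :: int}))
           (\<Pi>\<^sub>M i\<in>(UNIV :: nat set). count_space (UNIV :: int set))
           (\<lambda>\<xi> t. v + (\<Sum>i<t. \<xi> i))"

definition tie_law :: "(nat \<Rightarrow> real) measure" where
  "tie_law = (\<Pi>\<^sub>M t\<in>(UNIV :: nat set). uniform_measure lborel {0..1})"

definition parking_measure :: "real \<Rightarrow> outcome measure" where
  "parking_measure p =
     (\<Pi>\<^sub>M v\<in>(UNIV :: int set). initial_law p \<Otimes>\<^sub>M (walk_law v \<Otimes>\<^sub>M tie_law))"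

lemma prob_space_walk_law: "prob_space (walk_law v)"
proof -
  let ?M = "\<Pi>\<^sub>M i\<in>(UNIV :: nat set). measure_pmf (pmf_of_set {-1, 1 :: int})"
  have step: "(\<lambda>\<xi>. \<xi> t) \<in> ?M \<rightarrow>\<^sub>M count_space UNIV" for t
    using measurable_component_singleton[of t UNIV
        "\<lambda>_. measure_pmf (pmf_of_set {-1, 1 :: int})"] by simp
  have sum: "(\<lambda>\<xi>. v + (\<Sum>i<t. \<xi> i)) \<in> ?M \<rightarrow>\<^sub>M count_space UNIV" for t
  proof (induction t)
    case (Suc t)
    have "(\<lambda>\<xi>. (v + (\<Sum>i<t. \<xi> i)) + \<xi> t) \<in> ?M \<rightarrow>\<^sub>M count_space UNIV"
      by (rule measurable_compose_countable[OF _ Suc])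
         (rule measurable_compose[OF step], simp)
    then show ?case by (simp add: add.assoc)
  qed simp
  have "prob_space ?M"
    by (intro prob_space_PiM prob_space_measure_pmf)
  then show ?thesis
    unfolding walk_law_def
    by (rule prob_space.prob_space_distr) (auto intro!: measurable_PiM_single' sum)
qed

lemma prob_space_tie_law: "prob_space tie_law"
  unfolding tie_law_def by (intro prob_space_PiM prob_space_uniform_measure) auto

lemma prob_space_parking_measure: "prob_space (parking_measure p)"
  unfolding parking_measure_def initial_law_def
  by (intro prob_space_PiM prob_space_pair prob_space_walk_law prob_space_tie_law
      prob_space_measure_pmf)

definition initial :: "outcome \<Rightarrow> int \<Rightarrow> int" where
  "initial \<omega> v = fst (\<omega> v)"

definition walk :: "outcome \<Rightarrow> int \<Rightarrow> nat \<Rightarrow> int" where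
  "walk \<omega> v t = fst (snd (\<omega> v)) t"

definition tie :: "outcome \<Rightarrow> int \<Rightarrow> nat \<Rightarrow> real" where
  "tie \<omega> v t = snd (snd (\<omega> v)) t"

text \<open>
  Cars are named by their starting vertices. If \<open>A\<close> is the set of unparked cars and \<open>V\<close> the set
  of vacant spots just before time \<open>t\<close>, then \<open>parkers \<omega> t A V\<close> is the set of cars that park at
  time \<open>t\<close>. Among the cars arriving at a vacant spot the one with the largest tie-breaking variable
  parks; on the null event that the maximum is not unique, the largest starting vertex decides, so
  that exactly one of any finite nonempty set of arriving cars parks. With nearest-neighbour
  trajectories only finitely many cars can arrive at a given vertex at a given time.
\<close>

definition parkers :: "outcome \<Rightarrow> nat \<Rightarrow> int set \<Rightarrow> int set \<Rightarrow> int set" where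
  "parkers \<omega> t A V =
     {v \<in> A. walk \<omega> v t \<in> V \<and>
        (\<forall>w\<in>A. walk \<omega> w t = walk \<omega> v t \<longrightarrow>
           tie \<omega> w t < tie \<omega> v t \<or> (tie \<omega> w t = tie \<omega> v t \<and> w \<le> v))}"

text \<open>The pair of the set of unparked cars and the set of vacant spots after time \<open>t\<close>.\<close>

primrec state :: "outcome \<Rightarrow> nat \<Rightarrow> int set \<times> int set" where
  "state \<omega> 0 = ({v. initial \<omega> v = 1}, {x. initial \<omega> x = -1})"
| "state \<omega> (Suc t) =
     (case state \<omega> t of (A, V) \<Rightarrow>
        let K = parkers \<omega> (Suc t) A V in (A - K, V - (\<lambda>v. walk \<omega> v (Suc t)) ` K))"

definition parks :: "outcome \<Rightarrow> int \<Rightarrow> int \<Rightarrow> nat \<Rightarrow> bool" where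
  "parks \<omega> v x t \<longleftrightarrow>
     (\<exists>s. t = Suc s \<and> v \<in> parkers \<omega> t (fst (state \<omega> s)) (snd (state \<omega> s)) \<and> walk \<omega> v t = x)"

text \<open>
  The set below has at most one element; if it is empty, then its infimum is \<open>\<infinity>\<close>.
\<close>

definition parking_time :: "outcome \<Rightarrow> enat" where
  "parking_time \<omega> =
     (if initial \<omega> 0 = -1 then Inf {enat t | t. \<exists>v. parks \<omega> v 0 t} else 0)"

end

theory Submission imports Defs begin

text \<open>
  Reflecting the trajectory of one car after time \<open>s\<close> preserves the law and does not affect the
  process up to time \<open>s\<close>. Hence exponentials of sums of steps with bounded coefficients that depend
  on the past have subgaussian moments, although the cars interact.

  Upper bound: let \<open>M\<close> be a small multiple of \<open>\<surd>t\<close>. If the spot at the origin is still vacant at time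
  \<open>t\<close>, no car starting in \<open>(0, M)\<close> has left this interval through \<open>0\<close>, so the sum of the distances
  to \<open>M\<close> of these cars, stopped when they park or reach \<open>M\<close>, ends up below the sum of \<open>M - x\<close>
  over the spots \<open>x\<close>, about \<open>(1 - p) M\<^sup>2 / 2\<close>. It starts at about \<open>p M\<^sup>2 / 2\<close> and is a martingale
  with quadratic variation of order \<open>M t\<close>, so this has probability at most \<open>exp (- c M)\<close>.

  Lower bound: for \<open>L\<close> a large multiple of \<open>\<surd>t\<close>, all sites of \<open>[-L, L]\<close> are spots with probability
  \<open>(1 - p)\<^bsup>2 L + 1\<^esup>\<close>. A car from the right reaches the origin only after the \<open>L\<close> spots in \<open>(0, L]\<close>
  have been filled from the right, but the expected number of cars that enter this interval by time
  \<open>t\<close> is of order \<open>\<surd>t\<close>.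
\<close>

section \<open>Product measures\<close>

text \<open>The preimage of a cylinder set is the cylinder over the coordinatewise preimages, so
  both measures give it the same product; cylinders over finitely many coordinates determine a
  finite measure on the infinite product.\<close>

lemma distr_PiM_coordinatewise:
  assumes M: "\<And>i. i \<in> I \<Longrightarrow> prob_space (M i)"
    and f: "\<And>i. i \<in> I \<Longrightarrow> f i \<in> M i \<rightarrow>\<^sub>M M i"
    and inv: "\<And>i. i \<in> I \<Longrightarrow> distr (M i) (M i) (f i) = M i"
  shows "distr (Pi\<^sub>M I M) (Pi\<^sub>M I M) (\<lambda>\<omega>. \<lambda>i\<in>I. f i (\<omega> i)) = Pi\<^sub>M I M"
    (is "distr ?P ?P ?g = ?P")
proof (rule measure_eqI_PiM_infinite[symmetric, OF refl])
  interpret prob_space ?P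
    by (intro prob_space_PiM M)
  show "finite_measure ?P"
    by unfold_locales
  have g: "?g \<in> ?P \<rightarrow>\<^sub>M ?P"
    using f by (intro measurable_restrict) (auto intro: measurable_compose[OF measurable_component_singleton])
  show "sets (distr ?P ?P ?g) = sets ?P"
    by simp
  fix A J assume J: "finite J" "J \<subseteq> I" and A: "\<And>i. i \<in> J \<Longrightarrow> A i \<in> sets (M i)"
  have pre: "?g -` prod_emb I M J (Pi\<^sub>E J A) \<inter> space ?P
      = prod_emb I M J (\<Pi>\<^sub>E i\<in>J. f i -` A i \<inter> space (M i))"
    using J(2) measurable_space[OF f]
    by (auto simp: prod_emb_def space_PiM PiE_iff subset_iff Ball_def)
  have "emeasure (distr ?P ?P ?g) (prod_emb I M J (Pi\<^sub>E J A))
      = emeasure ?P (prod_emb I M J (\<Pi>\<^sub>E i\<in>J. f i -` A i \<inter> space (M i)))"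
    using J A g by (subst emeasure_distr) (auto simp: pre intro!: sets_PiM_I)
  also have "\<dots> = (\<Prod>i\<in>J. emeasure (M i) (f i -` A i \<inter> space (M i)))"
    using J A f by (intro emeasure_PiM_emb M) (auto intro!: measurable_sets)
  also have "\<dots> = (\<Prod>i\<in>J. emeasure (distr (M i) (M i) (f i)) (A i))"
    using J A f by (intro prod.cong refl) (auto simp: emeasure_distr)
  also have "\<dots> = (\<Prod>i\<in>J. emeasure (M i) (A i))"
    using J inv by (intro prod.cong refl) auto
  also have "\<dots> = emeasure ?P (prod_emb I M J (Pi\<^sub>E J A))"
    using J A by (intro emeasure_PiM_emb[symmetric] M) auto
  finally show "emeasure ?P (prod_emb I M J (Pi\<^sub>E J A))
      = emeasure (distr ?P ?P ?g) (prod_emb I M J (Pi\<^sub>E J A))" ..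
qed

text \<open>The integrand sees only the coordinates in \<open>J\<close>, so the infinite product can
  be replaced by its marginal on \<open>J\<close>, where Fubini applies.\<close>

lemma nn_integral_PiM_prod:
  assumes M: "\<And>i. prob_space (M i)" and J: "finite J" "J \<subseteq> I"
    and f: "\<And>i. i \<in> J \<Longrightarrow> f i \<in> borel_measurable (M i)"
  shows "(\<integral>\<^sup>+ x. (\<Prod>i\<in>J. f i (x i)) \<partial>Pi\<^sub>M I M) = (\<Prod>i\<in>J. \<integral>\<^sup>+ x. f i x \<partial>M i)"
proof -
  interpret product_prob_space M
    using M by (intro product_prob_spaceI)
  have meas: "(\<lambda>x. \<Prod>i\<in>J. f i (x i)) \<in> borel_measurable (Pi\<^sub>M J M)"
    using f by (intro borel_measurable_prod_ennreal)
      (auto intro: measurable_compose[OF measurable_component_singleton])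
  have "(\<Prod>i\<in>J. \<integral>\<^sup>+ x. f i x \<partial>M i) = (\<integral>\<^sup>+ x. (\<Prod>i\<in>J. f i (x i)) \<partial>Pi\<^sub>M J M)"
    using J f by (intro product_nn_integral_prod[symmetric]) auto
  also have "\<dots> = (\<integral>\<^sup>+ x. (\<Prod>i\<in>J. f i (x i)) \<partial>distr (Pi\<^sub>M I M) (Pi\<^sub>M J M) (\<lambda>x. restrict x J))"
    using J by (simp add: distr_PiM_restrict_finite)
  also have "\<dots> = (\<integral>\<^sup>+ x. (\<Prod>i\<in>J. f i (x i)) \<partial>Pi\<^sub>M I M)"
    using J meas by (subst nn_integral_distr) (auto intro!: nn_integral_cong measurable_restrict_subset)
  finally show ?thesis ..
qed

section \<open>Coordinates of the parking measure\<close>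

abbreviation site_law :: "real \<Rightarrow> int \<Rightarrow> (int \<times> (nat \<Rightarrow> int) \<times> (nat \<Rightarrow> real)) measure" where
  "site_law p v \<equiv> initial_law p \<Otimes>\<^sub>M (walk_law v \<Otimes>\<^sub>M tie_law)"

abbreviation coin_law :: "(nat \<Rightarrow> int) measure" where
  "coin_law \<equiv> \<Pi>\<^sub>M i\<in>(UNIV :: nat set). measure_pmf (pmf_of_set {-1, 1 :: int})"

lemma prob_space_site_law: "prob_space (site_law p v)"
  unfolding initial_law_def
  by (intro prob_space_pair prob_space_walk_law prob_space_tie_law prob_space_measure_pmf)

lemma sets_initial_law [measurable_cong, simp]: "sets (initial_law p) = sets (count_space UNIV)"
  by (simp add: initial_law_def)

lemma sets_walk_law [measurable_cong, simp]:
  "sets (walk_law v) = sets (\<Pi>\<^sub>M i\<in>(UNIV :: nat set). count_space (UNIV :: int set))"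
  by (simp add: walk_law_def)

lemma sets_tie_law [measurable_cong, simp]: "sets tie_law = sets (\<Pi>\<^sub>M i\<in>(UNIV :: nat set). borel)"
  unfolding tie_law_def by (rule sets_PiM_cong) auto

lemma space_parking_measure [simp]: "space (parking_measure p) = UNIV"
proof -
  have "space (initial_law p) = UNIV" "space (walk_law v) = UNIV" "space tie_law = UNIV" for v
    using sets_eq_imp_space_eq[OF sets_initial_law] sets_eq_imp_space_eq[OF sets_walk_law]
      sets_eq_imp_space_eq[OF sets_tie_law] by (auto simp: space_PiM)
  then show ?thesis
    by (simp add: parking_measure_def space_PiM space_pair_measure)
qed

lemma measurable_site: "(\<lambda>\<omega>. \<omega> v) \<in> parking_measure p \<rightarrow>\<^sub>M site_law p v"
  unfolding parking_measure_def by (rule measurable_component_singleton) simp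

lemma measurable_initial [measurable]:
  "(\<lambda>\<omega>. initial \<omega> v) \<in> parking_measure p \<rightarrow>\<^sub>M count_space UNIV"
proof -
  have "fst \<in> site_law p v \<rightarrow>\<^sub>M count_space UNIV" by measurable
  from measurable_compose[OF measurable_site this] show ?thesis
    by (simp add: initial_def)
qed

lemma measurable_walk [measurable]:
  "(\<lambda>\<omega>. walk \<omega> v s) \<in> parking_measure p \<rightarrow>\<^sub>M count_space UNIV"
proof -
  have "(\<lambda>z. fst (snd z) s) \<in> site_law p v \<rightarrow>\<^sub>M count_space UNIV" by measurable
  from measurable_compose[OF measurable_site this] show ?thesis
    by (simp add: walk_def)
qed

lemma measurable_tie [measurable]:
  "(\<lambda>\<omega>. tie \<omega> v s) \<in> borel_measurable (parking_measure p)"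
proof -
  have "(\<lambda>z. snd (snd z) s) \<in> site_law p v \<rightarrow>\<^sub>M borel" by measurable
  from measurable_compose[OF measurable_site this] show ?thesis
    by (simp add: tie_def)
qed

lemma pred_state:
  "Measurable.pred (parking_measure p) (\<lambda>\<omega>. v \<in> fst (state \<omega> s))"
  "Measurable.pred (parking_measure p) (\<lambda>\<omega>. v \<in> snd (state \<omega> s))"
proof (induction s arbitrary: v)
  case 0
  case 1 show ?case by simp
  case 2 show ?case by simp
next
  case (Suc s)
  note Suc[measurable]
  \<comment> \<open>The spot tested here is itself random; splitting over its countably many values
    reduces the claim to fixed spots.\<close>
  have vacant [measurable]: "Measurable.pred (parking_measure p)
      (\<lambda>\<omega>. walk \<omega> v (Suc s) \<in> snd (state \<omega> s))" for v
  proof -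
    have "Measurable.pred (parking_measure p)
        (\<lambda>\<omega>. \<exists>x. walk \<omega> v (Suc s) = x \<and> x \<in> snd (state \<omega> s))"
      by measurable
    then show ?thesis by simp
  qed
  have ties [measurable]: "Measurable.pred (parking_measure p)
      (\<lambda>\<omega>. tie \<omega> w (Suc s) = tie \<omega> v (Suc s))" for v w
    unfolding pred_def by (intro borel_measurable_eq measurable_tie)
  have parkers [measurable]: "Measurable.pred (parking_measure p)
      (\<lambda>\<omega>. v \<in> parkers \<omega> (Suc s) (fst (state \<omega> s)) (snd (state \<omega> s)))" for v
    unfolding parkers_def Ball_def mem_Collect_eq by measurable
  case 1
  show ?case by (simp add: Let_def split_beta)
  case 2
  show ?case by (simp add: Let_def split_beta image_iff Bex_def)
qed

section \<open>Steps of the trajectories and the almost sure nearest-neighbour property\<close>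

definition step :: "outcome \<Rightarrow> int \<Rightarrow> nat \<Rightarrow> int" where
  "step \<omega> v s = walk \<omega> v (Suc s) - walk \<omega> v s"

text \<open>An outcome may contain arbitrary integer sequences as trajectories. Pathwise arguments
  that rely on unit steps run on this event of full measure.\<close>

definition nearest_neighbour :: "outcome \<Rightarrow> bool" where
  "nearest_neighbour \<omega> \<longleftrightarrow> (\<forall>v. walk \<omega> v 0 = v \<and> (\<forall>s. \<bar>step \<omega> v s\<bar> = 1))"

lemma measurable_step [measurable]:
  "(\<lambda>\<omega>. step \<omega> v s) \<in> parking_measure p \<rightarrow>\<^sub>M count_space UNIV"
  unfolding step_def by measurable

lemma measurable_partial_sums [measurable]:
  "(\<lambda>\<xi> t. v + (\<Sum>i<t. \<xi> i)) \<in> coin_law \<rightarrow>\<^sub>M (\<Pi>\<^sub>M i\<in>(UNIV :: nat set). count_space (UNIV :: int set))"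
proof (rule measurable_PiM_single')
  have coin: "(\<lambda>\<xi>. \<xi> t) \<in> coin_law \<rightarrow>\<^sub>M count_space UNIV" for t
    using measurable_component_singleton[of t UNIV "\<lambda>_. measure_pmf (pmf_of_set {-1, 1 :: int})"] by simp
  show "(\<lambda>\<xi>. v + (\<Sum>i<t. \<xi> i)) \<in> coin_law \<rightarrow>\<^sub>M count_space UNIV" for t
  proof (induction t)
    case (Suc t)
    have "(\<lambda>\<xi>. (v + (\<Sum>i<t. \<xi> i)) + \<xi> t) \<in> coin_law \<rightarrow>\<^sub>M count_space UNIV"
      by (rule measurable_compose_countable[OF _ Suc])
         (rule measurable_compose[OF coin], simp)
    then show ?case by (simp add: add.assoc)
  qed simp
qed auto

lemma AE_walk_law: "AE w in walk_law v. w 0 = v \<and> (\<forall>s. \<bar>w (Suc s) - w s\<bar> = 1)"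
proof -
  have "AE \<xi> in coin_law. \<forall>s. \<bar>\<xi> s\<bar> = 1"
  proof (subst AE_all_countable, intro allI)
    fix s :: nat
    show "AE \<xi> in coin_law. \<bar>\<xi> s\<bar> = 1"
      by (rule AE_PiM_component) (auto simp: prob_space_measure_pmf AE_measure_pmf_iff)
  qed
  then show ?thesis
    unfolding walk_law_def
    by (subst AE_distr_iff[OF measurable_partial_sums]) (auto elim!: eventually_mono)
qed

lemma AE_site_law_walk:
  assumes "AE w in walk_law v. P w" and [measurable]: "Measurable.pred (walk_law v) P"
  shows "AE z in site_law p v. P (fst (snd z))"
proof -
  interpret W: prob_space "walk_law v" by (rule prob_space_walk_law)
  interpret T: prob_space tie_law by (rule prob_space_tie_law)
  interpret WT: prob_space "walk_law v \<Otimes>\<^sub>M tie_law"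
    by (intro prob_space_pair prob_space_walk_law prob_space_tie_law)
  interpret I: prob_space "initial_law p"
    by (simp add: initial_law_def prob_space_measure_pmf)
  interpret pair_sigma_finite "initial_law p" "walk_law v \<Otimes>\<^sub>M tie_law" ..
  have "AE y in walk_law v \<Otimes>\<^sub>M tie_law. P (fst y)"
    using assms(1) T.distr_pair_fst[of "walk_law v"] AE_distrD[of fst _ "walk_law v" P]
    by (metis measurable_fst)
  then show ?thesis
    by (intro AE_pair_measure) auto
qed

lemma AE_nearest_neighbour: "AE \<omega> in parking_measure p. nearest_neighbour \<omega>"
proof -
  have "AE \<omega> in parking_measure p. walk \<omega> v 0 = v \<and> (\<forall>s. \<bar>step \<omega> v s\<bar> = 1)" for v
    using AE_PiM_component[of UNIV "site_law p" v, OF prob_space_site_law _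
        AE_site_law_walk[OF AE_walk_law]]
    unfolding parking_measure_def walk_def step_def by simp
  then show ?thesis
    by (simp add: nearest_neighbour_def AE_all_countable)
qed

lemma nn_integral_initial_prod:
  assumes "finite J" and p: "0 \<le> p" "p \<le> 1"
  shows "(\<integral>\<^sup>+ \<omega>. (\<Prod>x\<in>J. g x (initial \<omega> x)) \<partial>parking_measure p)
    = (\<Prod>x\<in>J. ennreal p * g x 1 + ennreal (1 - p) * g x (-1))"
proof -
  have "(\<integral>\<^sup>+ z. g x (fst z) \<partial>site_law p x) = ennreal p * g x 1 + ennreal (1 - p) * g x (-1)" for x
  proof -
    interpret WT: prob_space "walk_law x \<Otimes>\<^sub>M tie_law"
      by (intro prob_space_pair prob_space_walk_law prob_space_tie_law)
    have "(\<integral>\<^sup>+ z. g x (fst z) \<partial>site_law p x)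
        = (\<integral>\<^sup>+ a. g x a \<partial>distr (site_law p x) (initial_law p) fst)"
      by (rule nn_integral_distr[symmetric]) auto
    also have "\<dots> = (\<integral>\<^sup>+ a. g x a \<partial>initial_law p)"
      by (simp add: WT.distr_pair_fst)
    also have "\<dots> = ennreal p * g x 1 + ennreal (1 - p) * g x (-1)"
      using p by (simp add: initial_law_def mult.commute)
    finally show ?thesis .
  qed
  then show ?thesis
    unfolding parking_measure_def initial_def using \<open>finite J\<close>
    by (subst nn_integral_PiM_prod[OF prob_space_site_law]) auto
qed

section \<open>Reflecting a trajectory\<close>

definition reflect :: "nat \<Rightarrow> (nat \<Rightarrow> int) \<Rightarrow> nat \<Rightarrow> int" where
  "reflect s w r = (if r \<le> s then w r else 2 * w s - w r)"

definition flip :: "int \<Rightarrow> nat \<Rightarrow> outcome \<Rightarrow> outcome" where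
  "flip v s \<omega> = (\<lambda>w. if w = v then (fst (\<omega> v), reflect s (fst (snd (\<omega> v))), snd (snd (\<omega> v))) else \<omega> w)"

lemma measurable_reflect [measurable]: "reflect s \<in> walk_law v \<rightarrow>\<^sub>M walk_law v"
proof -
  have "(\<lambda>w r. reflect s w r) \<in> walk_law v \<rightarrow>\<^sub>M (\<Pi>\<^sub>M i\<in>(UNIV :: nat set). count_space (UNIV :: int set))"
    unfolding reflect_def by (rule measurable_PiM_single') (auto intro!: measurable_If)
  then show ?thesis
    by (simp cong: measurable_cong_sets)
qed

lemma sum_reflect:
  "reflect s (\<lambda>t. v + (\<Sum>i<t. \<xi> i)) = (\<lambda>t. v + (\<Sum>i<t. if i < s then \<xi> i else - \<xi> i))"
proof
  fix r
  show "reflect s (\<lambda>t. v + (\<Sum>i<t. \<xi> i)) r = v + (\<Sum>i<r. if i < s then \<xi> i else - \<xi> i)"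
  proof (induction r)
    case (Suc r)
    then show ?case
      by (cases r s rule: linorder_cases) (auto simp: reflect_def algebra_simps)
  qed (simp add: reflect_def)
qed

text \<open>In terms of the coin flips, the reflection changes the sign of every coin with index at
  least \<open>s\<close>. The coins are independent and symmetric, so their joint law is
  unchanged.\<close>

lemma distr_reflect: "distr (walk_law v) (walk_law v) (reflect s) = walk_law v"
proof -
  let ?S = "\<lambda>\<xi> (t::nat). v + (\<Sum>i<t. \<xi> i)"
  let ?Z = "\<Pi>\<^sub>M i\<in>(UNIV :: nat set). count_space (UNIV :: int set)"
  let ?n = "\<lambda>\<xi>. \<lambda>i\<in>UNIV. (if i < s then \<lambda>x. x else uminus) (\<xi> i)"
  let ?coin = "measure_pmf (pmf_of_set {-1, 1 :: int})"
  have "map_pmf uminus (pmf_of_set {-1, 1 :: int}) = pmf_of_set {-1, 1}"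
    by (subst map_pmf_of_set_inj) (auto simp: insert_commute)
  then have "distr ?coin ?coin uminus = ?coin"
    by (metis distr_cong map_pmf_rep_eq sets_measure_pmf_count_space)
  then have coin: "distr coin_law coin_law ?n = coin_law"
    by (intro distr_PiM_coordinatewise) (auto simp: prob_space_measure_pmf distr_id2)
  have n: "?n \<in> coin_law \<rightarrow>\<^sub>M coin_law"
    by (rule measurable_restrict) (rule measurable_compose[OF measurable_component_singleton], auto)
  have refl: "reflect s \<in> ?Z \<rightarrow>\<^sub>M ?Z"
    using measurable_reflect[of s v] by (simp cong: measurable_cong_sets)
  have "distr (walk_law v) (walk_law v) (reflect s) = distr (walk_law v) ?Z (reflect s)"
    by (rule distr_cong) auto
  also have "\<dots> = distr coin_law ?Z (reflect s \<circ> ?S)"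
    unfolding walk_law_def by (rule distr_distr[OF refl measurable_partial_sums])
  also have "reflect s \<circ> ?S = ?S \<circ> ?n"
    by (auto simp: fun_eq_iff sum_reflect if_distrib if_distribR cong: if_cong intro!: sum.cong)
  also have "distr coin_law ?Z (?S \<circ> ?n) = distr (distr coin_law coin_law ?n) ?Z ?S"
    by (rule distr_distr[OF measurable_partial_sums n, symmetric])
  also have "\<dots> = walk_law v"
    by (simp only: coin walk_law_def)
  finally show ?thesis .
qed

lemma flip_measure_preserving:
  shows measurable_flip [measurable]: "flip v s \<in> parking_measure p \<rightarrow>\<^sub>M parking_measure p"
    and distr_flip: "distr (parking_measure p) (parking_measure p) (flip v s) = parking_measure p"
proof -
  let ?r = "\<lambda>z :: int \<times> (nat \<Rightarrow> int) \<times> (nat \<Rightarrow> real). (fst z, reflect s (fst (snd z)), snd (snd z))"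
  let ?f = "\<lambda>w. if w = v then ?r else (\<lambda>z. z)"
  have flip: "flip v s = (\<lambda>\<omega>. \<lambda>w\<in>UNIV. ?f w (\<omega> w))"
    by (auto simp: flip_def fun_eq_iff)
  have r [measurable]: "?r \<in> site_law p v \<rightarrow>\<^sub>M site_law p v" by measurable
  then have f: "?f w \<in> site_law p w \<rightarrow>\<^sub>M site_law p w" for w by simp
  show "flip v s \<in> parking_measure p \<rightarrow>\<^sub>M parking_measure p"
    unfolding parking_measure_def flip
    by (rule measurable_restrict) (rule measurable_compose[OF _ f], simp)
  interpret W: prob_space "walk_law v" by (rule prob_space_walk_law)
  interpret T: prob_space tie_law by (rule prob_space_tie_law)
  interpret WT: prob_space "walk_law v \<Otimes>\<^sub>M tie_law"
    by (intro prob_space_pair prob_space_walk_law prob_space_tie_law)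
  have "distr (walk_law v \<Otimes>\<^sub>M tie_law) (walk_law v \<Otimes>\<^sub>M tie_law) (\<lambda>(w, u). (reflect s w, u))
      = distr (walk_law v) (walk_law v) (reflect s) \<Otimes>\<^sub>M distr tie_law tie_law (\<lambda>u. u)"
    by (rule pair_measure_distr[symmetric]) (auto simp: distr_id2 T.sigma_finite_measure_axioms)
  also have "\<dots> = walk_law v \<Otimes>\<^sub>M tie_law"
    by (simp add: distr_reflect distr_id2)
  finally have WT: "distr (walk_law v \<Otimes>\<^sub>M tie_law) (walk_law v \<Otimes>\<^sub>M tie_law) (\<lambda>(w, u). (reflect s w, u))
      = walk_law v \<Otimes>\<^sub>M tie_law" .
  have "distr (site_law p v) (site_law p v) (\<lambda>(a, y). (a, (\<lambda>(w, u). (reflect s w, u)) y))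
      = distr (initial_law p) (initial_law p) (\<lambda>a. a) \<Otimes>\<^sub>M
        distr (walk_law v \<Otimes>\<^sub>M tie_law) (walk_law v \<Otimes>\<^sub>M tie_law) (\<lambda>(w, u). (reflect s w, u))"
    by (rule pair_measure_distr[symmetric]) (auto simp: WT WT.sigma_finite_measure_axioms)
  also have "\<dots> = site_law p v"
    by (simp add: WT distr_id2)
  also have "(\<lambda>(a, y). (a, (\<lambda>(w, u). (reflect s w, u)) y)) = ?r"
    by (auto simp: fun_eq_iff)
  finally have "distr (site_law p v) (site_law p v) ?r = site_law p v" .
  then have "distr (site_law p w) (site_law p w) (?f w) = site_law p w" for w
    by (simp add: distr_id2)
  then show "distr (parking_measure p) (parking_measure p) (flip v s) = parking_measure p"
    unfolding parking_measure_def flip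
    by (intro distr_PiM_coordinatewise prob_space_site_law f) auto
qed

section \<open>Exponential moments of predictable sums of steps\<close>

lemma exp_le_quadratic:
  fixes x :: real
  assumes "\<bar>x\<bar> \<le> 1"
  shows "exp x \<le> 1 + x + x\<^sup>2"
proof (cases "0 \<le> x")
  case True
  then show ?thesis using assms exp_bound by simp
next
  case False
  define y where "y = - x"
  have y: "0 < y" "y \<le> 1" using False assms by (auto simp: y_def)
  have "1 + y + y\<^sup>2 / 2 \<le> exp y" using y by (intro exp_lower_Taylor_quadratic) simp
  moreover have "0 < 1 + y + y\<^sup>2 / 2" using y by (simp add: add_pos_nonneg)
  ultimately have "exp (- y) \<le> 1 / (1 + y + y\<^sup>2 / 2)"
    by (simp add: exp_minus inverse_eq_divide frac_le)
  also have "\<dots> \<le> 1 - y + y\<^sup>2"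
  proof -
    \<comment> \<open>In the product of the claimed bound and the Taylor polynomial the linear terms
      cancel and all other coefficients are positive.\<close>
    have "1 \<le> 1 + y\<^sup>2 / 2 + y ^ 3 / 2 + y ^ 4 / 2" using y by simp
    also have "\<dots> = (1 - y + y\<^sup>2) * (1 + y + y\<^sup>2 / 2)"
      by (simp add: field_simps power2_eq_square power3_eq_cube power4_eq_xxxx)
    finally show ?thesis using \<open>0 < 1 + y + y\<^sup>2 / 2\<close> by (simp add: divide_le_eq)
  qed
  finally show ?thesis by (simp add: y_def)
qed

text \<open>For arguments of modulus at most 1 the linear terms of the two quadratic bounds cancel;
  beyond that, \<open>\<bar>x\<bar> \<le> x\<^sup>2\<close>. This is a subgaussian bound for a
  random sign.\<close>

lemma exp_add_exp_minus_le: "exp x + exp (- x) \<le> 2 * exp (x\<^sup>2)" for x :: real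
proof (cases "\<bar>x\<bar> \<le> 1")
  case True
  then have "exp x + exp (- x) \<le> 2 * (1 + x\<^sup>2)"
    using exp_le_quadratic[of x] exp_le_quadratic[of "- x"] by simp
  also have "\<dots> \<le> 2 * exp (x\<^sup>2)" by (intro mult_left_mono exp_ge_add_one_self) simp
  finally show ?thesis .
next
  case False
  then have "\<bar>x\<bar> * 1 \<le> \<bar>x\<bar> * \<bar>x\<bar>" by (intro mult_left_mono) auto
  then have "\<bar>x\<bar> \<le> x\<^sup>2" by (simp add: power2_eq_square)
  then have "x \<le> x\<^sup>2" "- x \<le> x\<^sup>2" by auto
  then have "exp x \<le> exp (x\<^sup>2)" "exp (- x) \<le> exp (x\<^sup>2)" by simp_all
  then show ?thesis by linarith
qed

section \<open>Effect of a reflection on the process\<close>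

lemma initial_flip [simp]: "initial (flip v s \<omega>) w = initial \<omega> w"
  by (simp add: initial_def flip_def)

lemma tie_flip [simp]: "tie (flip v s \<omega>) w r = tie \<omega> w r"
  by (simp add: tie_def flip_def)

lemma walk_flip: "r \<le> s \<Longrightarrow> walk (flip v s \<omega>) w r = walk \<omega> w r"
  by (simp add: walk_def flip_def reflect_def)

lemma step_flip:
  "step (flip v s \<omega>) w r = (if w = v \<and> s \<le> r then - step \<omega> w r else step \<omega> w r)"
  by (auto simp: step_def walk_def flip_def reflect_def not_less_eq_eq)

text \<open>The state at time \<open>t\<close> reads positions only up to time \<open>t\<close>, and
  a reflection at a time \<open>s\<close> no earlier than \<open>t\<close> leaves these
  unchanged.\<close>

lemma state_flip: "t \<le> s \<Longrightarrow> state (flip v s \<omega>) t = state \<omega> t"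
proof (induction t)
  case (Suc t)
  then have "parkers (flip v s \<omega>) (Suc t) A V = parkers \<omega> (Suc t) A V" for A V
    by (simp add: parkers_def walk_flip)
  then show ?case
    using Suc by (simp add: walk_flip split: prod.split)
qed simp

text \<open>
  \<open>past s f\<close> plays the role of measurability with respect to the information available before the
  steps with index at least \<open>s\<close> are revealed.
\<close>

definition past :: "nat \<Rightarrow> (outcome \<Rightarrow> 'a) \<Rightarrow> bool" where
  "past s f \<longleftrightarrow> (\<forall>v r \<omega>. s \<le> r \<longrightarrow> f (flip v r \<omega>) = f \<omega>)"

lemma pastD: "past s f \<Longrightarrow> s \<le> r \<Longrightarrow> f (flip v r \<omega>) = f \<omega>"
  by (simp add: past_def)

text \<open>Reflection preserves the law, \<open>\<Phi>\<close> and \<open>a\<close>, but negates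
  the step. The integral thus equals its average with the sign-reversed one, and
  \<open>exp_add_exp_minus_le\<close> bounds this average pointwise. Invariance under
  \<open>flip\<close> stands in for independence of the step.\<close>

lemma exp_step_bound:
  fixes \<Phi> :: "outcome \<Rightarrow> ennreal" and a :: "outcome \<Rightarrow> real"
  assumes [measurable]: "\<Phi> \<in> borel_measurable (parking_measure p)" "a \<in> borel_measurable (parking_measure p)"
    and inv: "\<And>\<omega>. \<Phi> (flip v s \<omega>) = \<Phi> \<omega>" "\<And>\<omega>. a (flip v s \<omega>) = a \<omega>"
    and C: "\<And>\<omega>. \<bar>a \<omega>\<bar> \<le> C"
  shows "(\<integral>\<^sup>+ \<omega>. \<Phi> \<omega> * ennreal (exp (a \<omega> * step \<omega> v s)) \<partial>parking_measure p)
    \<le> ennreal (exp (C\<^sup>2)) * (\<integral>\<^sup>+ \<omega>. \<Phi> \<omega> \<partial>parking_measure p)"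
proof -
  let ?P = "parking_measure p"
  let ?e = "\<lambda>\<eta> \<omega>. \<Phi> \<omega> * ennreal (exp (\<eta> * (a \<omega> * step \<omega> v s)))"
  have [measurable]: "?e \<eta> \<in> borel_measurable ?P" for \<eta> by measurable
  have "(\<integral>\<^sup>+ \<omega>. ?e 1 \<omega> \<partial>?P) = (\<integral>\<^sup>+ \<omega>. ?e 1 \<omega> \<partial>distr ?P ?P (flip v s))"
    by (simp only: distr_flip)
  also have "\<dots> = (\<integral>\<^sup>+ \<omega>. ?e (-1) \<omega> \<partial>?P)"
    by (subst nn_integral_distr) (simp_all add: inv step_flip)
  finally have sym: "(\<integral>\<^sup>+ \<omega>. ?e 1 \<omega> \<partial>?P) = (\<integral>\<^sup>+ \<omega>. ?e (-1) \<omega> \<partial>?P)" .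
  have pointwise: "exp (1 * (a \<omega> * step \<omega> v s)) + exp (- 1 * (a \<omega> * step \<omega> v s)) \<le> 2 * exp (C\<^sup>2)"
    if "nearest_neighbour \<omega>" for \<omega>
  proof -
    have "\<bar>step \<omega> v s\<bar> = 1" using that by (simp add: nearest_neighbour_def)
    then have "step \<omega> v s = 1 \<or> step \<omega> v s = - 1" by arith
    then have "(a \<omega> * step \<omega> v s)\<^sup>2 = (a \<omega>)\<^sup>2"
      by (auto simp: power_mult_distrib)
    also have "\<dots> \<le> C\<^sup>2" using C[of \<omega>] abs_le_square_iff[of "a \<omega>" C] by linarith
    finally have "2 * exp ((a \<omega> * step \<omega> v s)\<^sup>2) \<le> 2 * exp (C\<^sup>2)" by simp
    then show ?thesis
      using exp_add_exp_minus_le[of "a \<omega> * step \<omega> v s"]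
      unfolding mult_1 mult_minus1 by linarith
  qed
  have "2 * (\<integral>\<^sup>+ \<omega>. ?e 1 \<omega> \<partial>?P) = (\<integral>\<^sup>+ \<omega>. ?e 1 \<omega> + ?e (-1) \<omega> \<partial>?P)"
    by (subst nn_integral_add) (simp_all only: sym mult_2, measurable)
  also have "\<dots> \<le> (\<integral>\<^sup>+ \<omega>. \<Phi> \<omega> * ennreal (2 * exp (C\<^sup>2)) \<partial>?P)"
  proof (intro nn_integral_mono_AE, use AE_nearest_neighbour[of p] in eventually_elim)
    fix \<omega> assume "nearest_neighbour \<omega>"
    have "?e 1 \<omega> + ?e (-1) \<omega> = \<Phi> \<omega> *
        ennreal (exp (1 * (a \<omega> * step \<omega> v s)) + exp (- 1 * (a \<omega> * step \<omega> v s)))"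
      by (subst ennreal_plus) (simp_all only: distrib_left exp_ge_zero)
    also have "\<dots> \<le> \<Phi> \<omega> * ennreal (2 * exp (C\<^sup>2))"
      using \<open>nearest_neighbour \<omega>\<close> by (intro mult_left_mono ennreal_leI pointwise) auto
    finally show "?e 1 \<omega> + ?e (-1) \<omega> \<le> \<Phi> \<omega> * ennreal (2 * exp (C\<^sup>2))" .
  qed
  also have "\<dots> = (\<integral>\<^sup>+ \<omega>. \<Phi> \<omega> \<partial>?P) * (2 * ennreal (exp (C\<^sup>2)))"
    by (subst nn_integral_multc) (simp_all add: ennreal_mult')
  also have "\<dots> = 2 * (ennreal (exp (C\<^sup>2)) * (\<integral>\<^sup>+ \<omega>. \<Phi> \<omega> \<partial>?P))"
    by (simp only: mult_ac)
  finally show ?thesis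
    by (subst (asm) ennreal_mult_le_mult_iff) auto
qed

text \<open>The steps are removed one at a time, latest first, each at the cost of a factor
  \<open>exp (C\<^sup>2)\<close>. The outer induction runs over times, the inner one
  (\<open>layer\<close>) over the cars that move at the same time.\<close>

lemma exp_sum_bound:
  fixes \<Psi> :: "outcome \<Rightarrow> ennreal" and c :: "nat \<Rightarrow> int \<Rightarrow> outcome \<Rightarrow> real"
  assumes "finite F"
    and [measurable]: "\<Psi> \<in> borel_measurable (parking_measure p)"
      "\<And>s v. c s v \<in> borel_measurable (parking_measure p)"
    and \<Psi>: "past 0 \<Psi>" and c: "\<And>s v. past s (c s v)"
    and C: "\<And>s v \<omega>. \<bar>c s v \<omega>\<bar> \<le> C"
  shows "(\<integral>\<^sup>+ \<omega>. \<Psi> \<omega> * ennreal (exp (\<Sum>s<t. \<Sum>v\<in>F. c s v \<omega> * step \<omega> v s)) \<partial>parking_measure p)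
    \<le> ennreal (exp (C\<^sup>2 * card F * t)) * (\<integral>\<^sup>+ \<omega>. \<Psi> \<omega> \<partial>parking_measure p)"
proof (induction t)
  case (Suc t)
  let ?P = "parking_measure p"
  let ?I = "\<lambda>G. \<integral>\<^sup>+ \<omega>. \<Psi> \<omega> * ennreal (exp ((\<Sum>s<t. \<Sum>v\<in>F. c s v \<omega> * step \<omega> v s)
    + (\<Sum>v\<in>G. c t v \<omega> * step \<omega> v t))) \<partial>?P"
  have layer: "?I G \<le> ennreal (exp (C\<^sup>2 * card G)) * ?I {}" if "finite G" for G
    using that
  proof (induction G)
    case (insert w G)
    let ?\<Phi> = "\<lambda>\<omega>. \<Psi> \<omega> * ennreal (exp ((\<Sum>s<t. \<Sum>v\<in>F. c s v \<omega> * step \<omega> v s)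
      + (\<Sum>v\<in>G. c t v \<omega> * step \<omega> v t)))"
    \<comment> \<open>Reflecting \<open>w\<close> at time \<open>t\<close> changes only steps of
      \<open>w\<close> with index at least \<open>t\<close>, and none of these occurs in
      \<open>?\<Phi>\<close>.\<close>
    have "?\<Phi> (flip w t \<omega>) = ?\<Phi> \<omega>" for \<omega>
    proof -
      have "c s v (flip w t \<omega>) * step (flip w t \<omega>) v s = c s v \<omega> * step \<omega> v s" if "s < t" for s v
        using that pastD[OF c, of s t] by (simp add: step_flip)
      moreover have "c t v (flip w t \<omega>) * step (flip w t \<omega>) v t = c t v \<omega> * step \<omega> v t" if "v \<in> G" for v
        using that insert.hyps pastD[OF c, of t t] by (auto simp: step_flip)
      ultimately show ?thesis
        using pastD[OF \<Psi>, of t w \<omega>]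
        by (auto intro!: arg_cong2[where f = "(*)"] arg_cong[where f = "\<lambda>x. ennreal (exp x)"]
            arg_cong2[where f = "(+)"] sum.cong)
    qed
    then have "(\<integral>\<^sup>+ \<omega>. ?\<Phi> \<omega> * ennreal (exp (c t w \<omega> * step \<omega> w t)) \<partial>?P)
        \<le> ennreal (exp (C\<^sup>2)) * ?I G"
      using C pastD[OF c, of t t] by (intro exp_step_bound) auto
    also have "\<dots> \<le> ennreal (exp (C\<^sup>2)) * (ennreal (exp (C\<^sup>2 * card G)) * ?I {})"
      by (intro mult_left_mono insert.IH) auto
    also have "\<dots> = ennreal (exp (C\<^sup>2 * card (insert w G))) * ?I {}"
    proof -
      have "ennreal (exp (C\<^sup>2)) * ennreal (exp (C\<^sup>2 * card G)) = ennreal (exp (C\<^sup>2 * card (insert w G)))"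
        using insert.hyps by (simp add: ennreal_mult[symmetric] exp_add[symmetric] algebra_simps)
      then show ?thesis by (simp flip: mult.assoc)
    qed
    finally show ?case
      using insert.hyps by (simp add: exp_add ennreal_mult mult_ac)
  qed simp
  have "(\<integral>\<^sup>+ \<omega>. \<Psi> \<omega> * ennreal (exp (\<Sum>s<Suc t. \<Sum>v\<in>F. c s v \<omega> * step \<omega> v s)) \<partial>?P) = ?I F"
    by simp
  also have "\<dots> \<le> ennreal (exp (C\<^sup>2 * card F)) * ?I {}"
    by (rule layer[OF \<open>finite F\<close>])
  also have "\<dots> \<le> ennreal (exp (C\<^sup>2 * card F)) *
      (ennreal (exp (C\<^sup>2 * card F * t)) * (\<integral>\<^sup>+ \<omega>. \<Psi> \<omega> \<partial>?P))"
    using Suc.IH by (intro mult_left_mono) auto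
  also have "\<dots> = ennreal (exp (C\<^sup>2 * card F * Suc t)) * (\<integral>\<^sup>+ \<omega>. \<Psi> \<omega> \<partial>?P)"
  proof -
    have "ennreal (exp (C\<^sup>2 * card F)) * ennreal (exp (C\<^sup>2 * card F * t)) = ennreal (exp (C\<^sup>2 * card F * Suc t))"
      by (simp add: ennreal_mult[symmetric] exp_add[symmetric] algebra_simps)
    then show ?thesis by (simp flip: mult.assoc)
  qed
  finally show ?case .
qed simp

section \<open>Dynamics\<close>

abbreviation unparked :: "outcome \<Rightarrow> nat \<Rightarrow> int set" where
  "unparked \<omega> t \<equiv> fst (state \<omega> t)"

abbreviation vacant :: "outcome \<Rightarrow> nat \<Rightarrow> int set" where
  "vacant \<omega> t \<equiv> snd (state \<omega> t)"

lemma parks_Suc: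
  "parks \<omega> v x (Suc t) \<longleftrightarrow> v \<in> parkers \<omega> (Suc t) (unparked \<omega> t) (vacant \<omega> t) \<and> walk \<omega> v (Suc t) = x"
  by (simp add: parks_def)

lemma not_parks_0 [simp]: "\<not> parks \<omega> v x 0"
  by (simp add: parks_def)

lemma unparked_Suc: "v \<in> unparked \<omega> (Suc t) \<longleftrightarrow> v \<in> unparked \<omega> t \<and> (\<forall>x. \<not> parks \<omega> v x (Suc t))"
  by (auto simp: parks_Suc Let_def split_beta)

lemma vacant_Suc: "x \<in> vacant \<omega> (Suc t) \<longleftrightarrow> x \<in> vacant \<omega> t \<and> (\<forall>v. \<not> parks \<omega> v x (Suc t))"
  by (auto simp: parks_Suc Let_def split_beta)

lemma unparked_iff: "v \<in> unparked \<omega> t \<longleftrightarrow> initial \<omega> v = 1 \<and> (\<forall>s\<le>t. \<forall>x. \<not> parks \<omega> v x s)"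
proof (induction t)
  case (Suc t)
  then show ?case unfolding unparked_Suc by (auto simp: le_Suc_eq)
qed simp

lemma vacant_iff: "x \<in> vacant \<omega> t \<longleftrightarrow> initial \<omega> x = -1 \<and> (\<forall>s\<le>t. \<forall>v. \<not> parks \<omega> v x s)"
proof (induction t)
  case (Suc t)
  then show ?case unfolding vacant_Suc by (auto simp: le_Suc_eq)
qed simp

lemma unparked_antimono: "v \<in> unparked \<omega> t \<Longrightarrow> s \<le> t \<Longrightarrow> v \<in> unparked \<omega> s"
  by (auto simp: unparked_iff)

lemma vacant_antimono: "x \<in> vacant \<omega> t \<Longrightarrow> s \<le> t \<Longrightarrow> x \<in> vacant \<omega> s"
  by (auto simp: vacant_iff)

lemma parks_SucD:
  assumes "parks \<omega> v x (Suc t)"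
  shows "v \<in> unparked \<omega> t" "x \<in> vacant \<omega> t" "walk \<omega> v (Suc t) = x"
  using assms by (auto simp: parks_Suc parkers_def)

text \<open>A parked car is no longer unparked, so it parks at one time only, and at that time it
  has a single position.\<close>

lemma parks_inj_site:
  assumes "parks \<omega> v x s" "parks \<omega> v y t"
  shows "x = y"
proof -
  have "\<not> s < t" if "parks \<omega> v x s" "parks \<omega> v y t" for s t x y
  proof
    assume "s < t"
    then obtain r where r: "t = Suc r" "s \<le> r" by (cases t) auto
    then have "v \<in> unparked \<omega> r" using that(2) parks_SucD(1) by blast
    then show False using that(1) r(2) unfolding unparked_iff by blast
  qed
  then have "s = t" using assms by (meson linorder_neqE_nat)
  then show ?thesis using assms by (auto simp: parks_def)
qed

text \<open>A filled spot is no longer vacant, so both cars park at the same time; then the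
  tie-breaking order, refined by the starting vertex, is total and leaves one winner.\<close>

lemma parks_inj_car:
  assumes "parks \<omega> v x s" "parks \<omega> w x t"
  shows "v = w"
proof -
  have "\<not> s < t" if "parks \<omega> v x s" "parks \<omega> w x t" for s t v w
  proof
    assume "s < t"
    then obtain r where r: "t = Suc r" "s \<le> r" by (cases t) auto
    then have "x \<in> vacant \<omega> r" using that(2) parks_SucD(2) by blast
    then show False using that(1) r(2) unfolding vacant_iff by blast
  qed
  then have "s = t" using assms by (meson linorder_neqE_nat)
  with assms obtain r where "t = Suc r" and both: "parks \<omega> v x (Suc r)" "parks \<omega> w x (Suc r)"
    by (cases t) auto
  then have "tie \<omega> w (Suc r) < tie \<omega> v (Suc r) \<or> tie \<omega> w (Suc r) = tie \<omega> v (Suc r) \<and> w \<le> v"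
    "tie \<omega> v (Suc r) < tie \<omega> w (Suc r) \<or> tie \<omega> v (Suc r) = tie \<omega> w (Suc r) \<and> v \<le> w"
    by (simp_all add: parks_Suc parkers_def)
  then show ?thesis by linarith
qed

text \<open>Without a spot at the origin the parking time is 0 and the origin is never vacant; with
  one, the infimum of the empty set covers a spot that is never filled.\<close>

lemma less_parking_time_iff: "enat t < parking_time \<omega> \<longleftrightarrow> 0 \<in> vacant \<omega> t"
proof -
  have "enat t < Inf {enat s | s. \<exists>v. parks \<omega> v 0 s} \<longleftrightarrow> (\<forall>s v. parks \<omega> v 0 s \<longrightarrow> t < s)"
    unfolding Suc_ile_eq[symmetric] le_Inf_iff by (fastforce simp: Suc_le_eq)
  then show ?thesis
    by (auto simp: parking_time_def vacant_iff not_le zero_enat_def)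
qed

section \<open>Consequences of nearest-neighbour motion\<close>

lemma
  assumes "nearest_neighbour \<omega>"
  shows walk_0: "walk \<omega> v 0 = v"
    and abs_step: "\<bar>step \<omega> v s\<bar> = 1"
    and walk_dist: "\<bar>walk \<omega> v s - v\<bar> \<le> int s"
proof -
  show 0: "walk \<omega> v 0 = v" and step: "\<bar>step \<omega> v s\<bar> = 1" for s
    using assms by (auto simp: nearest_neighbour_def)
  show "\<bar>walk \<omega> v s - v\<bar> \<le> int s"
  proof (induction s)
    case (Suc s)
    then show ?case using step[of s] by (simp add: step_def)
  qed (simp add: 0)
qed

text \<open>Unit steps let only finitely many cars reach a given vertex at a given time, so the
  largest tie-breaking variable is attained; the largest starting vertex among those attaining it
  belongs to the winner.\<close>

lemma arrival_parks:
  assumes nn: "nearest_neighbour \<omega>" and v: "v \<in> unparked \<omega> s" and x: "walk \<omega> v (Suc s) \<in> vacant \<omega> s"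
  shows "\<exists>w. parks \<omega> w (walk \<omega> v (Suc s)) (Suc s)"
proof -
  define S where "S = {w \<in> unparked \<omega> s. walk \<omega> w (Suc s) = walk \<omega> v (Suc s)}"
  have "S \<subseteq> {walk \<omega> v (Suc s) - int (Suc s) .. walk \<omega> v (Suc s) + int (Suc s)}"
  proof
    fix w assume "w \<in> S"
    then show "w \<in> {walk \<omega> v (Suc s) - int (Suc s) .. walk \<omega> v (Suc s) + int (Suc s)}"
      using walk_dist[OF nn, of w "Suc s"] by (auto simp: S_def)
  qed
  then have fin: "finite S" by (rule finite_subset) simp
  have "v \<in> S" using v by (simp add: S_def)
  define m where "m = Max ((\<lambda>w. tie \<omega> w (Suc s)) ` S)"
  define S' where "S' = {w \<in> S. tie \<omega> w (Suc s) = m}"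
  have m: "m \<in> (\<lambda>w. tie \<omega> w (Suc s)) ` S" "\<And>w. w \<in> S \<Longrightarrow> tie \<omega> w (Suc s) \<le> m"
    using fin \<open>v \<in> S\<close> unfolding m_def by (auto intro!: Max_in)
  have S': "finite S'" "S' \<noteq> {}" using fin m(1) by (auto simp: S'_def)
  define w where "w = Max S'"
  have w: "w \<in> S'" "\<And>u. u \<in> S' \<Longrightarrow> u \<le> w" using S' by (auto simp: w_def)
  have "parks \<omega> w (walk \<omega> v (Suc s)) (Suc s)"
    using w m(2) x by (fastforce simp: parks_Suc parkers_def S'_def S_def)
  then show ?thesis ..
qed

text \<open>At time 0 the car stands on its own vertex, which is no spot; later each arrival at a
  vacant spot fills it, whoever wins. Time \<open>Suc s\<close> is included because the car still
  makes that move, and may itself park then.\<close>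

lemma visited_not_vacant:
  assumes nn: "nearest_neighbour \<omega>" and v: "v \<in> unparked \<omega> s" and r: "r \<le> Suc s"
  shows "walk \<omega> v r \<notin> vacant \<omega> r"
proof (cases r)
  case 0
  have "v \<in> unparked \<omega> 0" using v by (rule unparked_antimono) simp
  then show ?thesis using 0 walk_0[OF nn] by simp
next
  case (Suc q)
  then have "v \<in> unparked \<omega> q" using v r by (auto intro: unparked_antimono)
  then show ?thesis
    using arrival_parks[OF nn, of v q] unfolding Suc vacant_Suc by blast
qed

text \<open>
  Both half lines are treated at once by letting \<open>\<eta> = 1\<close> or \<open>\<eta> = -1\<close>.
\<close>

definition intruders :: "int \<Rightarrow> nat \<Rightarrow> nat \<Rightarrow> outcome \<Rightarrow> int set" where
  "intruders \<eta> L t \<omega> = {v. int L < \<eta> * v \<and> \<eta> * v \<le> int (L + t) \<and> (\<exists>s\<le>t. \<eta> * walk \<omega> v s \<le> int L)}"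

lemma finite_intruders:
  assumes "\<bar>\<eta>\<bar> = 1"
  shows "finite (intruders \<eta> L t \<omega>)"
proof (rule finite_subset)
  show "intruders \<eta> L t \<omega> \<subseteq> {- int (L + t) .. int (L + t)}"
    using assms by (auto simp: intruders_def abs_if split: if_splits)
qed simp

text \<open>This is the discrete intermediate value theorem for unit steps; the path is negated
  because it descends from \<open>\<eta> * v\<close> to at most \<open>y\<close>.\<close>

lemma walk_crossing:
  assumes nn: "nearest_neighbour \<omega>" and \<eta>: "\<bar>\<eta>\<bar> = 1"
    and y: "\<eta> * walk \<omega> v s \<le> y" "y \<le> \<eta> * v"
  shows "\<exists>r\<le>s. \<eta> * walk \<omega> v r = y"
proof -
  have "\<exists>i\<ge>0. i \<le> s \<and> - (\<eta> * walk \<omega> v i) = - y"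
  proof (rule nat_intermed_int_val)
    have "\<bar>- (\<eta> * walk \<omega> v (Suc i)) - - (\<eta> * walk \<omega> v i)\<bar> = \<bar>\<eta>\<bar> * \<bar>step \<omega> v i\<bar>" for i
      by (simp add: step_def algebra_simps flip: abs_mult)
    then show "\<forall>i. 0 \<le> i \<and> i < s \<longrightarrow> \<bar>- (\<eta> * walk \<omega> v (Suc i)) - - (\<eta> * walk \<omega> v i)\<bar> \<le> 1"
      using \<eta> abs_step[OF nn] by simp
  qed (use y walk_0[OF nn] in simp_all)
  then show ?thesis by auto
qed

text \<open>If \<open>v\<close> parks at the origin, then on its way it visits every spot of the
  barrier on its side, so all of these were filled earlier. The cars that filled them are distinct,
  start outside the barrier, and cannot have passed the still vacant origin: they are
  \<open>L\<close> intruders from the same side.\<close>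

lemma barrier:
  assumes nn: "nearest_neighbour \<omega>"
    and spots: "\<And>x. \<bar>x\<bar> \<le> int L \<Longrightarrow> initial \<omega> x = -1"
    and few: "\<And>\<eta>. \<bar>\<eta>\<bar> = 1 \<Longrightarrow> card (intruders \<eta> L t \<omega>) < L"
  shows "0 \<in> vacant \<omega> t"
proof (rule ccontr)
  assume "0 \<notin> vacant \<omega> t"
  then obtain v s where s: "Suc s \<le> t" and v: "parks \<omega> v 0 (Suc s)"
    using spots[of 0] by (auto simp: vacant_iff) (metis not_parks_0 not0_implies_Suc)
  note v' = parks_SucD[OF v]
  have outside: "int L < \<bar>w\<bar>" if w: "parks \<omega> w x r" for w x r
  proof (rule ccontr)
    assume "\<not> int L < \<bar>w\<bar>"
    then have "initial \<omega> w = -1" using spots[of w] by simp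
    moreover obtain r' where "r = Suc r'" using w by (cases r) auto
    then have "w \<in> unparked \<omega> r'" using w parks_SucD(1) by blast
    then have "initial \<omega> w = 1" unfolding unparked_iff by blast
    ultimately show False by simp
  qed
  define \<eta> where "\<eta> = sgn v"
  have v_out: "int L < \<bar>v\<bar>" using outside[OF v] .
  then have \<eta>: "\<bar>\<eta>\<bar> = 1" "\<eta> * v = \<bar>v\<bar>" by (auto simp: \<eta>_def abs_sgn mult.commute)
  have "\<eta> * \<eta> = 1" using \<eta>(1) by (auto simp: abs_if split: if_splits)
  have "\<exists>w r. parks \<omega> w (\<eta> * x) r \<and> w \<in> intruders \<eta> L t \<omega>" if x: "x \<in> {1..int L}" for x
  proof -
    have "\<eta> * walk \<omega> v (Suc s) \<le> x" "x \<le> \<eta> * v" using v'(3) x \<eta> v_out by auto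
    then obtain q where q: "q \<le> Suc s" "\<eta> * walk \<omega> v q = x"
      using walk_crossing[OF nn \<eta>(1)] by blast
    have "walk \<omega> v q = \<eta> * x" using q(2) \<open>\<eta> * \<eta> = 1\<close> by (metis mult.assoc mult_1)
    \<comment> \<open>At time \<open>Suc s\<close> the car is at 0, not at
      \<open>\<eta> * x\<close>, so the visit happened strictly before.\<close>
    moreover have "q \<le> s" using q v'(3) x by (cases "q = Suc s") auto
    ultimately have "\<eta> * x \<notin> vacant \<omega> q"
      using visited_not_vacant[OF nn v'(1), of q] by simp
    moreover have "initial \<omega> (\<eta> * x) = -1"
      using spots[of "\<eta> * x"] x \<eta>(1) by (simp add: abs_mult)
    ultimately obtain w r where r: "r \<le> q" and w: "parks \<omega> w (\<eta> * x) r"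
      by (auto simp: vacant_iff)
    then obtain r' where r': "r = Suc r'" by (cases r) auto
    note w' = parks_SucD[OF w[unfolded r']]
    have pos: "\<eta> * walk \<omega> w r = x"
      using w'(3) \<open>\<eta> * \<eta> = 1\<close> by (simp add: r' mult.assoc[symmetric])
    \<comment> \<open>Otherwise \<open>w\<close> would have visited the origin no later than time
      \<open>s\<close> and the spot there would have been filled already.\<close>
    have "0 < \<eta> * w"
    proof (rule ccontr)
      assume "\<not> 0 < \<eta> * w"
      then obtain k where k: "k \<le> r" "- \<eta> * walk \<omega> w k = 0"
        using walk_crossing[OF nn, of "- \<eta>" w r 0] \<eta>(1) pos x by auto
      then have "walk \<omega> w k = 0" using \<eta>(1) by auto
      then have "0 \<notin> vacant \<omega> k"
        using visited_not_vacant[OF nn w'(1), of k] k(1) r' by simp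
      then show False
        using vacant_antimono[OF v'(2), of k] k(1) r \<open>q \<le> s\<close> by simp
    qed
    then have "\<eta> * w = \<bar>w\<bar>" using \<eta>(1) by (metis abs_mult abs_of_pos mult_1)
    then have "int L < \<eta> * w" using outside[OF w] by simp
    moreover have "\<eta> * w \<le> int (L + t)"
    proof -
      have "\<bar>\<eta> * (walk \<omega> w r - w)\<bar> \<le> int r" using walk_dist[OF nn, of w r] \<eta>(1) by (simp add: abs_mult)
      then have "\<eta> * w \<le> x + int r" using pos by (simp add: algebra_simps)
      then show ?thesis using x r \<open>q \<le> s\<close> s by simp
    qed
    ultimately have "w \<in> intruders \<eta> L t \<omega>"
      using pos x r \<open>q \<le> s\<close> s by (auto simp: intruders_def intro!: exI[of _ r])
    then show ?thesis using w by blast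
  qed
  then obtain f where f: "\<And>x. x \<in> {1..int L} \<Longrightarrow> \<exists>r. parks \<omega> (f x) (\<eta> * x) r"
      "f ` {1..int L} \<subseteq> intruders \<eta> L t \<omega>"
    by atomize_elim (metis image_subsetI)
  have "inj_on f {1..int L}"
  proof (rule inj_onI)
    fix x y assume "x \<in> {1..int L}" "y \<in> {1..int L}" "f x = f y"
    then have "\<eta> * x = \<eta> * y" using f(1)[of x] f(1)[of y] parks_inj_site by metis
    then show "x = y" using \<eta>(1) by auto
  qed
  then have "card {1..int L} \<le> card (intruders \<eta> L t \<omega>)"
    using f(2) finite_intruders[OF \<eta>(1)] by (rule card_inj_on_le)
  then show False using few[OF \<eta>(1)] by simp
qed

section \<open>The lower bound\<close>

definition all_spots :: "nat \<Rightarrow> outcome set" where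
  "all_spots L = {\<omega>. \<forall>x\<in>{- int L..int L}. initial \<omega> x = -1}"

text \<open>The event concerns the trajectory alone, whether or not \<open>v\<close> holds a car and
  whether or not that car has parked. This removes the interaction from the count of
  intruders.\<close>

definition crosses :: "int \<Rightarrow> nat \<Rightarrow> int \<Rightarrow> nat \<Rightarrow> outcome \<Rightarrow> bool" where
  "crosses \<eta> L v t \<omega> \<longleftrightarrow> (\<exists>s\<le>t. \<eta> * walk \<omega> v s \<le> int L)"

lemma sets_all_spots [measurable]: "all_spots L \<in> sets (parking_measure p)"
proof -
  have [measurable]: "Measurable.pred (parking_measure p) (\<lambda>\<omega>. initial \<omega> x = -1)" for x
    by (rule measurable_compose[OF measurable_initial]) simp
  have "{\<omega> \<in> space (parking_measure p). \<forall>x\<in>{- int L..int L}. initial \<omega> x = -1} \<in> sets (parking_measure p)"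
    by measurable
  then show ?thesis by (simp add: all_spots_def)
qed

lemma pred_crosses [measurable]: "Measurable.pred (parking_measure p) (crosses \<eta> L v t)"
proof -
  have [measurable]: "Measurable.pred (parking_measure p) (\<lambda>\<omega>. \<eta> * walk \<omega> v s \<le> int L)" for s
    by (rule measurable_compose[OF measurable_walk]) simp
  show ?thesis unfolding crosses_def by measurable
qed

lemma past_crosses: "past t (crosses \<eta> L v t)"
proof -
  have "crosses \<eta> L v t (flip w r \<omega>) \<longleftrightarrow> crosses \<eta> L v t \<omega>" if "t \<le> r" for w r \<omega>
    unfolding crosses_def using walk_flip[OF le_trans[OF _ that]] by (intro ex_cong1) auto
  then show ?thesis by (simp add: past_def)
qed

lemma prob_all_spots:
  assumes "0 \<le> p" "p \<le> 1"
  shows "measure (parking_measure p) (all_spots L) = (1 - p) ^ (2 * L + 1)"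
proof -
  have "emeasure (parking_measure p) (all_spots L)
      = (\<integral>\<^sup>+ \<omega>. (\<Prod>x\<in>{- int L..int L}. indicator {-1} (initial \<omega> x)) \<partial>parking_measure p)"
  proof (subst nn_integral_indicator[symmetric])
    have "indicator (all_spots L) \<omega> = (\<Prod>x\<in>{- int L..int L}. indicator {-1} (initial \<omega> x) :: ennreal)" for \<omega>
    proof (cases "\<omega> \<in> all_spots L")
      case True
      then show ?thesis by (simp add: all_spots_def)
    next
      case False
      then obtain x where "x \<in> {- int L..int L}" "initial \<omega> x \<noteq> -1" by (auto simp: all_spots_def)
      then have "(\<Prod>x\<in>{- int L..int L}. indicator {-1} (initial \<omega> x) :: ennreal) = 0"
        by (intro prod_zero bexI[of _ x]) auto
      then show ?thesis using False by simp
    qed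
    then show "(\<integral>\<^sup>+ \<omega>. indicator (all_spots L) \<omega> \<partial>parking_measure p)
        = (\<integral>\<^sup>+ \<omega>. (\<Prod>x\<in>{- int L..int L}. indicator {-1} (initial \<omega> x)) \<partial>parking_measure p)"
      by simp
  qed simp
  also have "\<dots> = ennreal (1 - p) ^ (2 * L + 1)"
    using assms by (subst nn_integral_initial_prod) (auto simp: nat_add_distrib nat_mult_distrib)
  also have "\<dots> = ennreal ((1 - p) ^ (2 * L + 1))"
    using assms by (intro ennreal_power) simp
  finally show ?thesis
    using assms by (simp add: measure_def)
qed

text \<open>The coefficients vanish after the first crossing, so \<open>S\<close> is
  \<open>\<theta>\<close> times the displacement towards the barrier, frozen at that time.\<close>

lemma stopped_sum:
  fixes \<eta> :: int and L :: nat and \<theta> :: real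
  assumes start: "walk \<omega> v 0 = v" "int L < \<eta> * v" and "0 \<le> \<theta>"
  defines "S \<equiv> \<lambda>t. \<Sum>s<t. (if crosses \<eta> L v s \<omega> then 0 else - \<theta> * \<eta>) * step \<omega> v s"
  shows "if crosses \<eta> L v t \<omega> then \<theta> * (\<eta> * v - int L) \<le> S t
    else S t = \<theta> * (\<eta> * v - \<eta> * walk \<omega> v t)"
proof (induction t)
  case 0
  then show ?case using start by (simp add: crosses_def S_def)
next
  case (Suc t)
  have cr: "crosses \<eta> L v (Suc t) \<omega> \<longleftrightarrow> crosses \<eta> L v t \<omega> \<or> \<eta> * walk \<omega> v (Suc t) \<le> int L"
    by (auto simp: crosses_def le_Suc_eq)
  show ?case
  proof (cases "crosses \<eta> L v t \<omega>")
    case True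
    then show ?thesis using Suc.IH cr by (simp add: S_def)
  next
    case False
    then have S: "S (Suc t) = \<theta> * (\<eta> * v - \<eta> * walk \<omega> v (Suc t))"
      using Suc.IH by (simp add: S_def step_def algebra_simps)
    show ?thesis
    proof (cases "crosses \<eta> L v (Suc t) \<omega>")
      case True
      then have "\<eta> * walk \<omega> v (Suc t) \<le> int L" using cr False by simp
      then have "real_of_int (\<eta> * v) - int L \<le> \<eta> * v - \<eta> * walk \<omega> v (Suc t)"
        by (simp flip: of_int_mult)
      then show ?thesis using True S \<open>0 \<le> \<theta>\<close> by (simp add: mult_left_mono)
    qed (simp add: S)
  qed
qed

text \<open>A Chernoff bound: on the crossing event the stopped sum is at least
  \<open>\<theta> * n\<close>, while its coefficients are bounded by \<open>\<theta>\<close>. The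
  indicator of \<open>all_spots L\<close> depends on the initial contents only, so it passes through
  \<open>exp_sum_bound\<close> as the factor \<open>\<Psi>\<close>.\<close>

lemma prob_crosses_le:
  fixes \<theta> :: real and n L :: nat
  assumes \<eta>: "\<bar>\<eta>\<bar> = 1" and "0 < n" and \<theta>: "0 \<le> \<theta>"
  defines "v \<equiv> \<eta> * int (L + n)"
  shows "measure (parking_measure p) (all_spots L \<inter> {\<omega>. crosses \<eta> L v t \<omega>})
    \<le> exp (\<theta>\<^sup>2 * t - \<theta> * n) * measure (parking_measure p) (all_spots L)"
proof -
  let ?P = "parking_measure p" and ?J = "all_spots L"
  interpret prob_space ?P by (rule prob_space_parking_measure)
  have "\<eta> * \<eta> = 1" using \<eta> by (auto simp: abs_if split: if_splits)
  then have v: "\<eta> * v = int (L + n)" by (simp add: v_def mult.assoc[symmetric])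
  have vr: "real_of_int \<eta> * real_of_int v = L + n"
    using v by (metis of_int_mult of_int_of_nat_eq of_nat_add)
  define c :: "nat \<Rightarrow> int \<Rightarrow> outcome \<Rightarrow> real"
    where "c s w \<omega> = (if crosses \<eta> L v s \<omega> then 0 else - \<theta> * \<eta>)" for s w \<omega>
  define S where "S \<omega> = (\<Sum>s<t. \<Sum>w\<in>{v}. c s w \<omega> * step \<omega> w s)" for \<omega>
  have [measurable]: "c s w \<in> borel_measurable ?P" for s w
    unfolding c_def by measurable
  have J: "past 0 (indicator ?J :: outcome \<Rightarrow> ennreal)"
    by (simp add: past_def all_spots_def indicator_def)
  have c: "past s (c s w)" for s w
    using past_crosses[of s \<eta> L v] by (simp add: past_def c_def)
  have C: "\<bar>c s w \<omega>\<bar> \<le> \<theta>" for s w \<omega>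
    using \<theta> \<eta> by (simp add: c_def abs_mult flip: of_int_abs)
  have [measurable]: "Measurable.pred ?P (\<lambda>\<omega>. crosses \<eta> L v t \<omega>)" by measurable
  then have cr [measurable]: "{\<omega>. crosses \<eta> L v t \<omega>} \<in> sets ?P"
    by (simp add: pred_def)
  have "ennreal (measure ?P (?J \<inter> {\<omega>. crosses \<eta> L v t \<omega>}))
      = (\<integral>\<^sup>+ \<omega>. indicator (?J \<inter> {\<omega>. crosses \<eta> L v t \<omega>}) \<omega> \<partial>?P)"
    using cr by (simp add: emeasure_eq_measure)
  also have "\<dots> \<le> (\<integral>\<^sup>+ \<omega>. ennreal (exp (- \<theta> * n)) * (indicator ?J \<omega> * ennreal (exp (S \<omega>))) \<partial>?P)"
  proof (intro nn_integral_mono_AE, use AE_nearest_neighbour[of p] in eventually_elim)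
    fix \<omega> assume "nearest_neighbour \<omega>"
    then have "walk \<omega> v 0 = v" by (rule walk_0)
    then have "\<theta> * n \<le> S \<omega>" if "crosses \<eta> L v t \<omega>"
      using stopped_sum[of \<omega> v L \<eta> \<theta> t] that v \<open>0 < n\<close> \<theta> by (simp add: S_def c_def vr)
    then have "1 \<le> exp (- \<theta> * n) * exp (S \<omega>)" if "crosses \<eta> L v t \<omega>"
      using that by (simp flip: exp_add)
    then show "indicator (?J \<inter> {\<omega>. crosses \<eta> L v t \<omega>}) \<omega>
        \<le> ennreal (exp (- \<theta> * n)) * (indicator ?J \<omega> * ennreal (exp (S \<omega>)))"
      by (auto simp: indicator_def simp flip: ennreal_mult ennreal_1 intro!: ennreal_leI)
  qed
  also have "\<dots> = ennreal (exp (- \<theta> * n)) * (\<integral>\<^sup>+ \<omega>. indicator ?J \<omega> * ennreal (exp (S \<omega>)) \<partial>?P)"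
    unfolding S_def by (rule nn_integral_cmult) measurable
  also have "\<dots> \<le> ennreal (exp (- \<theta> * n)) * (ennreal (exp (\<theta>\<^sup>2 * card {v} * t)) * (\<integral>\<^sup>+ \<omega>. indicator ?J \<omega> \<partial>?P))"
    unfolding S_def using J c C by (intro mult_left_mono exp_sum_bound) auto
  also have "\<dots> = ennreal (exp (\<theta>\<^sup>2 * t - \<theta> * n) * measure ?P ?J)"
  proof -
    have eq: "exp (\<theta>\<^sup>2 * t - \<theta> * n) * measure ?P ?J = exp (- \<theta> * n) * (exp (\<theta>\<^sup>2 * card {v} * t) * measure ?P ?J)"
      by (simp add: algebra_simps flip: exp_add)
    show ?thesis unfolding eq by (simp add: emeasure_eq_measure ennreal_mult)
  qed
  finally show ?thesis by (subst (asm) ennreal_le_iff) auto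
qed

lemma intruders_card_le:
  assumes \<eta>: "\<bar>\<eta>\<bar> = 1"
  shows "card (intruders \<eta> L t \<omega>) \<le> (\<Sum>n\<in>{1..t}. of_bool (crosses \<eta> L (\<eta> * int (L + n)) t \<omega>))"
proof -
  let ?A = "{n \<in> {1..t}. crosses \<eta> L (\<eta> * int (L + n)) t \<omega>}"
  have "\<eta> * \<eta> = 1" using \<eta> by (auto simp: abs_if split: if_splits)
  have "intruders \<eta> L t \<omega> \<subseteq> (\<lambda>n. \<eta> * int (L + n)) ` ?A"
  proof
    fix v assume v: "v \<in> intruders \<eta> L t \<omega>"
    define n where "n = nat (\<eta> * v) - L"
    have n: "int (L + n) = \<eta> * v" "n \<in> {1..t}" using v by (auto simp: n_def intruders_def)
    have "v = \<eta> * int (L + n)" using n(1) \<open>\<eta> * \<eta> = 1\<close> by (simp add: mult.assoc[symmetric])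
    then show "v \<in> (\<lambda>n. \<eta> * int (L + n)) ` ?A"
      using v n(2) by (auto simp: intruders_def crosses_def)
  qed
  then have "card (intruders \<eta> L t \<omega>) \<le> card ((\<lambda>n. \<eta> * int (L + n)) ` ?A)"
    by (intro card_mono) auto
  also have "\<dots> \<le> card ?A" by (rule card_image_le) simp
  also have "\<dots> = (\<Sum>n\<in>{1..t}. of_bool (crosses \<eta> L (\<eta> * int (L + n)) t \<omega>))"
    by (simp add: Int_def)
  finally show ?thesis .
qed

text \<open>The inequality \<open>1 + \<theta> \<le> exp \<theta>\<close> bounds
  \<open>\<theta>\<close> times each term by a difference of consecutive exponentials, and these
  differences telescope.\<close>

lemma sum_exp_le:
  fixes \<theta> :: real
  assumes "0 < \<theta>"
  shows "(\<Sum>n\<in>{1..t}. exp (- \<theta> * real n)) \<le> 1 / \<theta>"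
proof -
  have "\<theta> * (\<Sum>n\<in>{1..t}. exp (- \<theta> * real n)) \<le> 1 - exp (- \<theta> * real t)"
  proof (induction t)
    case (Suc t)
    have "exp (- \<theta> * real t) = exp \<theta> * exp (- \<theta> * real (Suc t))"
      by (simp add: algebra_simps flip: exp_add)
    moreover have "(1 + \<theta>) * exp (- \<theta> * real (Suc t)) \<le> exp \<theta> * exp (- \<theta> * real (Suc t))"
      by (intro mult_right_mono exp_ge_add_one_self) simp
    ultimately show ?case using Suc by (simp add: algebra_simps)
  qed simp
  also have "\<dots> \<le> 1" by simp
  finally show ?thesis using assms by (simp add: field_simps)
qed

text \<open>On \<open>all_spots L\<close>, the origin can be filled only if some side has at least
  \<open>L\<close> intruders. The expected number of crossings on this event is at most
  \<open>6 * sqrt t\<close> times its probability (two sides, \<open>exp 1 \<le> 3\<close>), so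
  Markov's inequality with \<open>12 * sqrt t \<le> L\<close> leaves half of that
  probability.\<close>

lemma lower_bound:
  fixes t L :: nat
  assumes p: "0 \<le> p" "p \<le> 1" and t: "1 \<le> t" and L: "12 * sqrt t \<le> L"
  shows "(1 - p) ^ (2 * L + 1) / 2 \<le> measure (parking_measure p) {\<omega>. 0 \<in> vacant \<omega> t}"
proof -
  let ?P = "parking_measure p" and ?J = "all_spots L" and ?V = "{\<omega>. 0 \<in> vacant \<omega> t}"
  let ?X = "\<lambda>\<eta> n. ?J \<inter> {\<omega>. crosses \<eta> L (\<eta> * int (L + n)) t \<omega>}"
  interpret prob_space ?P by (rule prob_space_parking_measure)
  have V [measurable]: "?V \<in> sets ?P" using pred_state(2)[where p = p and v = 0 and s = t] by (simp add: pred_def)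
  have X [measurable]: "?X \<eta> n \<in> sets ?P" for \<eta> n
    using pred_crosses by (intro sets.Int) (simp_all add: pred_def)
  \<comment> \<open>This choice makes \<open>\<theta>\<^sup>2 * t\<close> equal to 1, so the bounds
    for single trajectories sum to order \<open>sqrt t\<close>.\<close>
  define \<theta> where "\<theta> = 1 / sqrt t"
  have \<theta>: "0 < \<theta>" "\<theta>\<^sup>2 * t = 1" using t by (simp_all add: \<theta>_def power_divide)
  have "ennreal (L * measure ?P (?J - ?V)) = (\<integral>\<^sup>+ \<omega>. ennreal L * indicator (?J - ?V) \<omega> \<partial>?P)"
    by (simp add: nn_integral_cmult emeasure_eq_measure ennreal_mult)
  also have "\<dots> \<le> (\<integral>\<^sup>+ \<omega>. (\<Sum>\<eta>\<in>{1, -1}. \<Sum>n\<in>{1..t}. indicator (?X \<eta> n) \<omega>) \<partial>?P)"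
  proof (intro nn_integral_mono_AE, use AE_nearest_neighbour[of p] in eventually_elim)
    fix \<omega> assume nn: "nearest_neighbour \<omega>"
    show "ennreal L * indicator (?J - ?V) \<omega> \<le> (\<Sum>\<eta>\<in>{1, -1}. \<Sum>n\<in>{1..t}. indicator (?X \<eta> n) \<omega>)"
    proof (cases "\<omega> \<in> ?J - ?V")
      case True
      let ?N = "\<lambda>\<eta>. \<Sum>n\<in>{1..t}. of_bool (crosses \<eta> L (\<eta> * int (L + n)) t \<omega>) :: nat"
      have "\<exists>\<eta>. \<bar>\<eta>\<bar> = 1 \<and> L \<le> card (intruders \<eta> L t \<omega>)"
      proof (rule ccontr)
        assume few: "\<not> (\<exists>\<eta>. \<bar>\<eta>\<bar> = 1 \<and> L \<le> card (intruders \<eta> L t \<omega>))"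
        have "0 \<in> vacant \<omega> t"
        proof (rule barrier[OF nn])
          show "initial \<omega> x = -1" if "\<bar>x\<bar> \<le> int L" for x
          proof -
            have "x \<in> {- int L..int L}" using that by (simp add: abs_le_iff)
            then show ?thesis using True unfolding all_spots_def by blast
          qed
          show "card (intruders \<eta> L t \<omega>) < L" if "\<bar>\<eta>\<bar> = 1" for \<eta>
            using that few by (meson not_le)
        qed
        then show False using True by simp
      qed
      then obtain \<eta> where \<eta>: "\<bar>\<eta>\<bar> = 1" "L \<le> ?N \<eta>"
        using intruders_card_le le_trans by blast
      then have "\<eta> = 1 \<or> \<eta> = -1" by arith
      then have "L \<le> (\<Sum>\<eta>\<in>{1, -1}. ?N \<eta>)" using \<eta>(2) by auto
      then have "ennreal L \<le> of_nat (\<Sum>\<eta>\<in>{1, -1}. ?N \<eta>)"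
        unfolding ennreal_of_nat_eq_real_of_nat by (intro ennreal_leI of_nat_mono)
      also have "\<dots> = (\<Sum>\<eta>\<in>{1, -1}. \<Sum>n\<in>{1..t}. indicator (?X \<eta> n) \<omega>)"
        unfolding of_nat_sum using True by (intro sum.cong refl) (auto simp: indicator_def)
      finally show ?thesis using True by simp
    qed simp
  qed
  also have "\<dots> = ennreal (\<Sum>\<eta>\<in>{1, -1}. \<Sum>n\<in>{1..t}. measure ?P (?X \<eta> n))"
    using X by (simp add: nn_integral_add nn_integral_sum emeasure_eq_measure sum_nonneg)
  finally have "L * measure ?P (?J - ?V) \<le> (\<Sum>\<eta>\<in>{1, -1}. \<Sum>n\<in>{1..t}. measure ?P (?X \<eta> n))"
    by (subst (asm) ennreal_le_iff) (auto intro!: sum_nonneg add_nonneg_nonneg)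
  also have "\<dots> \<le> (\<Sum>\<eta>\<in>{1 :: int, -1}. \<Sum>n\<in>{1..t}. exp (- \<theta> * real n) * (3 * measure ?P ?J))"
  proof (intro sum_mono)
    fix \<eta> :: int and n assume *: "\<eta> \<in> {1, -1}" "n \<in> {1..t}"
    have "measure ?P (?X \<eta> n) \<le> exp (\<theta>\<^sup>2 * t - \<theta> * n) * measure ?P ?J"
      using * \<theta> by (intro prob_crosses_le) auto
    also have "\<dots> = exp (- \<theta> * n) * (exp 1 * measure ?P ?J)"
      by (simp add: \<theta> exp_diff exp_minus divide_inverse)
    also have "\<dots> \<le> exp (- \<theta> * n) * (3 * measure ?P ?J)"
      using exp_le by (intro mult_left_mono mult_right_mono) auto
    finally show "measure ?P (?X \<eta> n) \<le> exp (- \<theta> * n) * (3 * measure ?P ?J)" .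
  qed
  also have "\<dots> = 2 * ((\<Sum>n\<in>{1..t}. exp (- \<theta> * real n)) * (3 * measure ?P ?J))"
    by (simp add: sum_distrib_right)
  also have "\<dots> \<le> 2 * (1 / \<theta> * (3 * measure ?P ?J))"
    using sum_exp_le[OF \<theta>(1), of t] by (intro mult_left_mono mult_right_mono) auto
  also have "\<dots> = (12 * sqrt t) * (measure ?P ?J / 2)" by (simp add: \<theta>_def)
  also have "\<dots> \<le> L * (measure ?P ?J / 2)" using L by (intro mult_right_mono) auto
  finally have "L * measure ?P (?J - ?V) \<le> L * (measure ?P ?J / 2)" .
  moreover have "0 < sqrt t" using t by simp
  then have "0 < real L" using L by linarith
  ultimately have "measure ?P (?J - ?V) \<le> measure ?P ?J / 2" by simp
  moreover have "measure ?P ?J \<le> measure ?P (?J - ?V) + measure ?P ?V"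
  proof -
    have "measure ?P ?J \<le> measure ?P ((?J - ?V) \<union> ?V)" by (intro finite_measure_mono) auto
    also have "\<dots> \<le> measure ?P (?J - ?V) + measure ?P ?V" by (intro measure_Un_le) auto
    finally show ?thesis .
  qed
  ultimately show ?thesis using prob_all_spots[OF p, of L] by simp
qed

section \<open>The upper bound\<close>

text \<open>
  A car is active in \<open>(0, M)\<close> as long as it is unparked and has not left this interval. With
  \<open>\<kappa> = M / t\<close>, the potential \<open>(M - X\<^sub>s) - \<kappa> (X\<^sub>s (M - X\<^sub>s) + s)\<close> is a martingale along the
  trajectory of an active car, and minus its increment is \<open>drift\<close> times the step. The linear part is at
  most \<open>M - x\<close> for a car that parks at \<open>x\<close> and vanishes for a car that leaves at \<open>M\<close>; the
  quadratic correction serves only to make the potential of a car that is still active at time \<open>t\<close>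
  nonpositive.
\<close>

definition active :: "nat \<Rightarrow> outcome \<Rightarrow> nat \<Rightarrow> int \<Rightarrow> bool" where
  "active M \<omega> s v \<longleftrightarrow> v \<in> unparked \<omega> s \<and> (\<forall>r\<le>s. 0 < walk \<omega> v r \<and> walk \<omega> v r < int M)"

definition drift :: "nat \<Rightarrow> real \<Rightarrow> nat \<Rightarrow> int \<Rightarrow> outcome \<Rightarrow> real" where
  "drift M \<kappa> s v \<omega> = (if active M \<omega> s v then 1 + \<kappa> * (real M - 2 * walk \<omega> v s) else 0)"

text \<open>A car parks at most once, so at most one term is nonzero. Writing the weight as a sum
  over spots allows summation over cars and over spots to be exchanged.\<close>

definition parked_weight :: "nat \<Rightarrow> outcome \<Rightarrow> int \<Rightarrow> nat \<Rightarrow> real" where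
  "parked_weight M \<omega> v t = (\<Sum>x\<in>{1..<int M}. of_bool (\<exists>r\<le>t. parks \<omega> v x r) * (real M - x))"

definition potential :: "nat \<Rightarrow> real \<Rightarrow> int \<Rightarrow> nat \<Rightarrow> real" where
  "potential M \<kappa> x s = (real M - x) - \<kappa> * (x * (real M - x) + s)"

text \<open>A car contributes at least \<open>\<delta>\<close> times its distance to
  \<open>M\<close>, while a spot absorbs at most its own distance. The value 0 covers contents other
  than 1 and -1, which the type of outcomes permits.\<close>

definition site_weight :: "nat \<Rightarrow> real \<Rightarrow> int \<Rightarrow> int \<Rightarrow> real" where
  "site_weight M \<delta> x a = (if a = 1 then \<delta> * (real M - x) else if a = -1 then - (real M - x) else 0)"

section \<open>Pathwise lower bound for the martingale when the origin is vacant\<close>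

lemma parked_weight_mono:
  assumes "s \<le> t"
  shows "parked_weight M \<omega> v s \<le> parked_weight M \<omega> v t"
  unfolding parked_weight_def
proof (intro sum_mono mult_right_mono)
  fix x assume "x \<in> {1..<int M}"
  then show "0 \<le> real M - x" by simp
  have "(\<exists>r\<le>s. parks \<omega> v x r) \<Longrightarrow> \<exists>r\<le>t. parks \<omega> v x r" using assms le_trans by blast
  then show "(of_bool (\<exists>r\<le>s. parks \<omega> v x r) :: real) \<le> of_bool (\<exists>r\<le>t. parks \<omega> v x r)" by auto
qed

lemma parked_weight_nonneg: "0 \<le> parked_weight M \<omega> v t"
  unfolding parked_weight_def by (intro sum_nonneg) auto

lemma parked_weight_ge:
  assumes "parks \<omega> v x s" "s \<le> t" "0 < x" "x < int M"
  shows "real M - x \<le> parked_weight M \<omega> v t"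
proof -
  have "real M - x = of_bool (\<exists>r\<le>t. parks \<omega> v x r) * (real M - x)"
    using assms by auto
  also have "\<dots> \<le> parked_weight M \<omega> v t"
    unfolding parked_weight_def
    by (rule member_le_sum[where f = "\<lambda>x. of_bool (\<exists>r\<le>t. parks \<omega> v x r) * (real M - x)"])
      (use assms in auto)
  finally show ?thesis .
qed

text \<open>Since the squared step is 1, \<open>x * (M - x)\<close> changes by
  \<open>(M - 2 * x)\<close> times the step, minus 1; the time term cancels this -1.\<close>

lemma potential_step:
  assumes "\<bar>step \<omega> v s\<bar> = 1"
  shows "potential M \<kappa> (walk \<omega> v (Suc s)) (Suc s)
    = potential M \<kappa> (walk \<omega> v s) s - (1 + \<kappa> * (real M - 2 * walk \<omega> v s)) * step \<omega> v s"
proof -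
  have w: "walk \<omega> v (Suc s) = walk \<omega> v s + step \<omega> v s" by (simp add: step_def)
  have "step \<omega> v s = 1 \<or> step \<omega> v s = -1" using assms by arith
  then show ?thesis unfolding w by (auto simp: potential_def algebra_simps)
qed

text \<open>The sum telescopes while the car is active and is frozen afterwards. Activity cannot end
  at the still vacant origin; at \<open>M\<close> the potential is nonpositive, and on parking at
  \<open>x\<close> it is at most \<open>M - x\<close>, the amount recorded in
  \<open>parked_weight\<close>.\<close>

lemma car_sum_invariant:
  fixes \<kappa> :: real
  assumes nn: "nearest_neighbour \<omega>" and vac: "0 \<in> vacant \<omega> t" and "0 \<le> \<kappa>" and act: "active M \<omega> 0 v"
    and "s \<le> t"
  defines "S \<equiv> \<lambda>s. \<Sum>r<s. drift M \<kappa> r v \<omega> * step \<omega> v r"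
  shows "if active M \<omega> s v then S s = potential M \<kappa> v 0 - potential M \<kappa> (walk \<omega> v s) s
    else potential M \<kappa> v 0 - parked_weight M \<omega> v s \<le> S s"
  using \<open>s \<le> t\<close>
proof (induction s)
  case 0
  then show ?case using act walk_0[OF nn] by (simp add: S_def)
next
  case (Suc s)
  let ?x = "walk \<omega> v (Suc s)"
  show ?case
  proof (cases "active M \<omega> s v")
    case False
    then have "\<not> active M \<omega> (Suc s) v"
      unfolding active_def using unparked_antimono[of v \<omega> "Suc s" s] le_SucI by blast
    moreover have "S (Suc s) = S s" using False by (simp add: S_def drift_def)
    ultimately show ?thesis
      using Suc False parked_weight_mono[of s "Suc s" M \<omega> v] by simp
  next
    case True
    have step: "\<bar>step \<omega> v s\<bar> = 1" by (rule abs_step[OF nn])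
    have S: "S (Suc s) = potential M \<kappa> v 0 - potential M \<kappa> ?x (Suc s)"
      unfolding potential_step[OF step] using Suc True by (simp add: S_def drift_def)
    have unp: "v \<in> unparked \<omega> s" using True by (simp add: active_def)
    have x: "0 \<le> ?x" "?x \<le> int M"
      using True step by (auto simp: active_def step_def dest!: spec[of _ s])
    have "?x \<noteq> 0"
      using visited_not_vacant[OF nn unp, of "Suc s"] vacant_antimono[OF vac Suc.prems] by auto
    show ?thesis
    proof (cases "active M \<omega> (Suc s) v")
      case False
      have "potential M \<kappa> ?x (Suc s) \<le> parked_weight M \<omega> v (Suc s)"
      proof (cases "?x = int M")
        case True
        then have "potential M \<kappa> ?x (Suc s) \<le> 0" using \<open>0 \<le> \<kappa>\<close> by (simp add: potential_def)
        then show ?thesis using parked_weight_nonneg[of M \<omega> v "Suc s"] by linarith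
      next
        case neq: False
        then have inside: "0 < ?x" "?x < int M" using x \<open>?x \<noteq> 0\<close> by auto
        then have "v \<notin> unparked \<omega> (Suc s)"
          using False True by (auto simp: active_def le_Suc_eq)
        then obtain y where y: "parks \<omega> v y (Suc s)" using unp unfolding unparked_Suc by blast
        then have "parks \<omega> v ?x (Suc s)" using parks_SucD(3) by metis
        then have "real M - ?x \<le> parked_weight M \<omega> v (Suc s)"
          using inside by (intro parked_weight_ge) auto
        moreover have "0 \<le> \<kappa> * (?x * (M - ?x) + Suc s)"
          using \<open>0 \<le> \<kappa>\<close> inside by (intro mult_nonneg_nonneg add_nonneg_nonneg) auto
        ultimately show ?thesis by (simp add: potential_def)
      qed
      then show ?thesis using False S by simp
    qed (simp add: S)
  qed
qed

text \<open>With \<open>\<kappa> * t = M\<close>, a car still active at time \<open>t\<close> at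
  position \<open>x\<close> has potential \<open>- x - \<kappa> * x * (M - x)\<close>, which is
  nonpositive. Hence the lower bound of the inactive case holds in both cases.\<close>

lemma car_sum_ge:
  fixes \<kappa> :: real
  assumes nn: "nearest_neighbour \<omega>" and vac: "0 \<in> vacant \<omega> t" and \<kappa>: "0 \<le> \<kappa>" "real M = \<kappa> * t"
    and v: "0 < v" "v < int M"
  shows "of_bool (initial \<omega> v = 1) * ((1 - \<kappa> * M) * (M - v)) - parked_weight M \<omega> v t
    \<le> (\<Sum>s<t. drift M \<kappa> s v \<omega> * step \<omega> v s)"
proof (cases "initial \<omega> v = 1")
  case False
  then have "\<not> active M \<omega> s v" for s by (auto simp: active_def unparked_iff)
  then show ?thesis using False parked_weight_nonneg[of M \<omega> v t] by (simp add: drift_def)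
next
  case True
  then have act: "active M \<omega> 0 v" using v walk_0[OF nn] by (simp add: active_def)
  let ?S = "\<Sum>s<t. drift M \<kappa> s v \<omega> * step \<omega> v s"
  have inv: "if active M \<omega> t v then ?S = potential M \<kappa> v 0 - potential M \<kappa> (walk \<omega> v t) t
    else potential M \<kappa> v 0 - parked_weight M \<omega> v t \<le> ?S"
    using car_sum_invariant[OF nn vac \<kappa>(1) act order_refl] .
  have "potential M \<kappa> v 0 - parked_weight M \<omega> v t \<le> ?S"
  proof (cases "active M \<omega> t v")
    case active: True
    let ?x = "real_of_int (walk \<omega> v t)"
    have "0 < walk \<omega> v t" "walk \<omega> v t < int M" using active by (auto simp: active_def)
    then have x: "0 \<le> ?x" "0 \<le> real M - ?x" by simp_all
    then have "0 \<le> \<kappa> * (?x * (M - ?x))" using \<kappa> by (intro mult_nonneg_nonneg)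
    then have "potential M \<kappa> (walk \<omega> v t) t \<le> 0"
      using x \<kappa>(2) by (simp add: potential_def distrib_left)
    then show ?thesis using inv active parked_weight_nonneg[of M \<omega> v t] by simp
  qed (use inv in simp)
  \<comment> \<open>Bounding \<open>v\<close> by \<open>M\<close> in the quadratic correction makes
    the initial potential a fixed multiple of the distance to \<open>M\<close>.\<close>
  moreover have "(1 - \<kappa> * M) * (M - v) \<le> potential M \<kappa> v 0"
  proof -
    have "\<kappa> * v * (real M - v) \<le> \<kappa> * M * (real M - v)"
      using \<kappa> v by (intro mult_right_mono mult_left_mono) auto
    then show ?thesis by (simp add: potential_def algebra_simps)
  qed
  ultimately show ?thesis using True by simp
qed

text \<open>After exchanging summations, each spot in the interval is charged for at most one car,
  so the total parked weight is at most the sum of distances over the spots.\<close>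

lemma total_sum_ge:
  fixes \<kappa> :: real
  assumes nn: "nearest_neighbour \<omega>" and vac: "0 \<in> vacant \<omega> t" and \<kappa>: "0 \<le> \<kappa>" "real M = \<kappa> * t"
  shows "(\<Sum>x\<in>{1..<int M}. site_weight M (1 - \<kappa> * M) x (initial \<omega> x))
    \<le> (\<Sum>s<t. \<Sum>v\<in>{1..<int M}. drift M \<kappa> s v \<omega> * step \<omega> v s)"
proof -
  let ?F = "{1..<int M}"
  have "(\<Sum>v\<in>?F. parked_weight M \<omega> v t)
      = (\<Sum>x\<in>?F. (\<Sum>v\<in>?F. of_bool (\<exists>r\<le>t. parks \<omega> v x r)) * (real M - x))"
    unfolding parked_weight_def by (subst sum.swap) (simp add: sum_distrib_right)
  also have "\<dots> \<le> (\<Sum>x\<in>?F. of_bool (initial \<omega> x = -1) * (real M - x))"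
  proof (intro sum_mono mult_right_mono)
    fix x assume "x \<in> ?F"
    show "(\<Sum>v\<in>?F. of_bool (\<exists>r\<le>t. parks \<omega> v x r)) \<le> (of_bool (initial \<omega> x = -1) :: real)"
    proof (cases "\<exists>w r. parks \<omega> w x r")
      case True
      then obtain w r where w: "parks \<omega> w x r" by blast
      then obtain r' where "r = Suc r'" by (cases r) auto
      then have "x \<in> vacant \<omega> r'" using w parks_SucD(2) by blast
      then have "initial \<omega> x = -1" unfolding vacant_iff by blast
      moreover have "(\<Sum>v\<in>?F. of_bool (\<exists>r\<le>t. parks \<omega> v x r)) \<le> (\<Sum>v\<in>?F. if v = w then 1 else (0 :: real))"
        using parks_inj_car[OF _ w] by (intro sum_mono) auto
      then have "(\<Sum>v\<in>?F. of_bool (\<exists>r\<le>t. parks \<omega> v x r)) \<le> (1 :: real)"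
        by (simp split: if_splits)
      ultimately show ?thesis by simp
    qed simp
  qed simp
  finally have "(\<Sum>v\<in>?F. of_bool (initial \<omega> v = 1) * ((1 - \<kappa> * M) * (real M - v)))
      - (\<Sum>x\<in>?F. of_bool (initial \<omega> x = -1) * (real M - x))
      \<le> (\<Sum>v\<in>?F. of_bool (initial \<omega> v = 1) * ((1 - \<kappa> * M) * (real M - v)) - parked_weight M \<omega> v t)"
    by (simp add: sum_subtractf)
  also have "\<dots> \<le> (\<Sum>v\<in>?F. \<Sum>s<t. drift M \<kappa> s v \<omega> * step \<omega> v s)"
    using car_sum_ge[OF nn vac \<kappa>] by (intro sum_mono) auto
  also have "\<dots> = (\<Sum>s<t. \<Sum>v\<in>?F. drift M \<kappa> s v \<omega> * step \<omega> v s)"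
    by (rule sum.swap)
  also have "(\<Sum>v\<in>?F. of_bool (initial \<omega> v = 1) * ((1 - \<kappa> * M) * (real M - v)))
      - (\<Sum>x\<in>?F. of_bool (initial \<omega> x = -1) * (real M - x))
      = (\<Sum>x\<in>?F. site_weight M (1 - \<kappa> * M) x (initial \<omega> x))"
    unfolding sum_subtractf[symmetric] by (intro sum.cong) (auto simp: site_weight_def)
  finally show ?thesis .
qed

section \<open>Exponential bounds for the probability that the origin stays vacant\<close>

lemma measurable_drift: "drift M \<kappa> s v \<in> borel_measurable (parking_measure p)"
proof -
  have [measurable]: "Measurable.pred (parking_measure p) (\<lambda>\<omega>. 0 < walk \<omega> v r \<and> walk \<omega> v r < int M)" for r
    by (rule measurable_compose[OF measurable_walk]) simp
  have [measurable]: "Measurable.pred (parking_measure p) (\<lambda>\<omega>. v \<in> unparked \<omega> s)"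
    by (rule pred_state)
  have [measurable]: "(\<lambda>\<omega>. 1 + \<kappa> * (real M - 2 * walk \<omega> v s)) \<in> borel_measurable (parking_measure p)"
    by (rule measurable_compose[OF measurable_walk]) simp
  show ?thesis unfolding drift_def active_def by measurable
qed

lemma past_drift: "past s (drift M \<kappa> s v)"
proof -
  have "active M (flip w r \<omega>) s v \<longleftrightarrow> active M \<omega> s v" if "s \<le> r" for w r \<omega>
    unfolding active_def state_flip[OF that] using walk_flip[OF le_trans[OF _ that]] by auto
  then show ?thesis by (simp add: past_def drift_def walk_flip)
qed

lemma abs_drift_le:
  fixes \<kappa> :: real
  assumes "0 \<le> \<kappa>" "\<kappa> * M \<le> 1"
  shows "\<bar>drift M \<kappa> s v \<omega>\<bar> \<le> 2"
proof (cases "active M \<omega> s v")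
  case True
  then have "0 < walk \<omega> v s" "walk \<omega> v s < int M" by (auto simp: active_def)
  then have "\<bar>real M - 2 * walk \<omega> v s\<bar> \<le> M" by (simp add: abs_le_iff)
  then have "\<bar>\<kappa> * (real M - 2 * walk \<omega> v s)\<bar> \<le> \<kappa> * M"
    using assms by (simp add: abs_mult mult_left_mono)
  then show ?thesis using True assms by (simp add: drift_def)
qed (simp add: drift_def)

text \<open>Exponential Markov inequality for \<open>total_sum_ge\<close>. The site weights depend
  on the initial contents only and form the factor \<open>\<Psi>\<close>;
  \<open>exp_sum_bound\<close> removes the steps of fewer than \<open>M\<close> cars with
  coefficients at most \<open>2 * \<theta>\<close>, and the rest factorizes over independent
  sites.\<close>

lemma prob_vacant_le_prod:
  fixes \<theta> :: real and M t :: nat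
  assumes p: "0 \<le> p" "p \<le> 1" and t: "1 \<le> t" "M\<^sup>2 \<le> t" and \<theta>: "0 \<le> \<theta>"
  defines "\<delta> \<equiv> 1 - M\<^sup>2 / t"
  shows "measure (parking_measure p) {\<omega>. 0 \<in> vacant \<omega> t} \<le> exp (4 * \<theta>\<^sup>2 * M * t) *
    (\<Prod>x\<in>{1..<int M}. p * exp (- (\<theta> * \<delta> * (M - x))) + (1 - p) * exp (\<theta> * (M - x)))"
proof -
  let ?P = "parking_measure p" and ?V = "{\<omega>. 0 \<in> vacant \<omega> t}" and ?F = "{1..<int M}"
  interpret prob_space ?P by (rule prob_space_parking_measure)
  \<comment> \<open>The correction then reaches \<open>M\<close> exactly at time \<open>t\<close>,
    and \<open>M\<^sup>2 \<le> t\<close> gives \<open>\<kappa> * M \<le> 1\<close>, the condition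
    for the drift to be bounded by 2.\<close>
  define \<kappa> where "\<kappa> = M / t"
  have \<kappa>: "0 \<le> \<kappa>" "real M = \<kappa> * t" "\<kappa> * M \<le> 1" "1 - \<kappa> * M = \<delta>"
  proof -
    have "real (M\<^sup>2) \<le> real t" using t by (intro of_nat_mono)
    then show "\<kappa> * M \<le> 1" using t by (simp add: \<kappa>_def power2_eq_square)
  qed (use t in \<open>simp_all add: \<kappa>_def \<delta>_def power2_eq_square\<close>)
  define c where "c s v \<omega> = \<theta> * drift M \<kappa> s v \<omega>" for s v \<omega>
  define g where "g x a = ennreal (exp (- (\<theta> * site_weight M \<delta> x a)))" for x a
  define \<Psi> where "\<Psi> \<omega> = (\<Prod>x\<in>?F. g x (initial \<omega> x))" for \<omega>
  have [measurable]: "(\<lambda>\<omega>. g x (initial \<omega> x)) \<in> borel_measurable ?P" for x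
    by (rule measurable_compose[OF measurable_initial]) simp
  have \<Psi> [measurable]: "\<Psi> \<in> borel_measurable ?P" unfolding \<Psi>_def by measurable
  have c [measurable]: "c s v \<in> borel_measurable ?P" for s v
    unfolding c_def using measurable_drift by (intro borel_measurable_times) auto
  have V [measurable]: "?V \<in> sets ?P" using pred_state(2)[where p = p and v = 0 and s = t] by (simp add: pred_def)
  have \<Psi>_eq: "\<Psi> \<omega> = ennreal (exp (- (\<theta> * (\<Sum>x\<in>?F. site_weight M \<delta> x (initial \<omega> x)))))" for \<omega>
    by (simp add: \<Psi>_def g_def prod_ennreal sum_distrib_left sum_negf[symmetric] exp_sum)
  have "ennreal (measure ?P ?V) = (\<integral>\<^sup>+ \<omega>. indicator ?V \<omega> \<partial>?P)"
    by (simp add: emeasure_eq_measure)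
  also have "\<dots> \<le> (\<integral>\<^sup>+ \<omega>. \<Psi> \<omega> * ennreal (exp (\<Sum>s<t. \<Sum>v\<in>?F. c s v \<omega> * step \<omega> v s)) \<partial>?P)"
  proof (intro nn_integral_mono_AE, use AE_nearest_neighbour[of p] in eventually_elim)
    fix \<omega> assume nn: "nearest_neighbour \<omega>"
    let ?S = "\<Sum>s<t. \<Sum>v\<in>?F. drift M \<kappa> s v \<omega> * step \<omega> v s"
    have S: "(\<Sum>s<t. \<Sum>v\<in>?F. c s v \<omega> * step \<omega> v s) = \<theta> * ?S"
      by (simp add: c_def sum_distrib_left mult.assoc)
    have "1 \<le> exp (- (\<theta> * (\<Sum>x\<in>?F. site_weight M \<delta> x (initial \<omega> x)))) * exp (\<theta> * ?S)"
      if "\<omega> \<in> ?V"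
    proof -
      have "(\<Sum>x\<in>?F. site_weight M \<delta> x (initial \<omega> x)) \<le> ?S"
        using total_sum_ge[OF nn _ \<kappa>(1,2)] that \<kappa>(4) by simp
      then have "\<theta> * (\<Sum>x\<in>?F. site_weight M \<delta> x (initial \<omega> x)) \<le> \<theta> * ?S"
        using \<theta> by (rule mult_left_mono)
      then show ?thesis by (simp flip: exp_add)
    qed
    then show "indicator ?V \<omega> \<le> \<Psi> \<omega> * ennreal (exp (\<Sum>s<t. \<Sum>v\<in>?F. c s v \<omega> * step \<omega> v s))"
      unfolding S \<Psi>_eq
      by (cases "\<omega> \<in> ?V") (simp_all flip: ennreal_mult ennreal_1 add: ennreal_leI)
  qed
  also have "\<dots> \<le> ennreal (exp ((2 * \<theta>)\<^sup>2 * card ?F * t)) * (\<integral>\<^sup>+ \<omega>. \<Psi> \<omega> \<partial>?P)"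
  proof (intro exp_sum_bound \<Psi> c)
    show "past 0 \<Psi>" by (simp add: past_def \<Psi>_def)
    show "past s (c s v)" for s v
      using past_drift[of s M \<kappa> v] by (simp add: past_def c_def)
    show "\<bar>c s v \<omega>\<bar> \<le> 2 * \<theta>" for s v \<omega>
      using mult_left_mono[OF abs_drift_le[OF \<kappa>(1,3), of s v \<omega>] \<theta>] \<theta> by (simp add: c_def abs_mult mult.commute)
  qed simp
  also have "(\<integral>\<^sup>+ \<omega>. \<Psi> \<omega> \<partial>?P) = ennreal (\<Prod>x\<in>?F. p * exp (- (\<theta> * \<delta> * (M - x))) + (1 - p) * exp (\<theta> * (M - x)))"
  proof -
    have "g x 1 = ennreal (exp (- (\<theta> * \<delta> * (M - x))))" "g x (-1) = ennreal (exp (\<theta> * (M - x)))" for x :: int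
      by (simp_all add: g_def site_weight_def algebra_simps)
    then have factor: "ennreal p * g x 1 + ennreal (1 - p) * g x (-1)
        = ennreal (p * exp (- (\<theta> * \<delta> * (M - x))) + (1 - p) * exp (\<theta> * (M - x)))" for x :: int
      using p by (simp add: ennreal_plus ennreal_mult)
    show ?thesis
      unfolding \<Psi>_def nn_integral_initial_prod[OF finite_atLeastLessThan_int p] factor using p
      by (intro prod_ennreal add_nonneg_nonneg mult_nonneg_nonneg) auto
  qed
  also have "ennreal (exp ((2 * \<theta>)\<^sup>2 * card ?F * t)) * \<dots> = ennreal (exp ((2 * \<theta>)\<^sup>2 * card ?F * t) *
      (\<Prod>x\<in>?F. p * exp (- (\<theta> * \<delta> * (M - x))) + (1 - p) * exp (\<theta> * (M - x))))"
    using p by (intro ennreal_mult[symmetric] prod_nonneg add_nonneg_nonneg ballI) auto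
  finally have "measure ?P ?V \<le> exp ((2 * \<theta>)\<^sup>2 * card ?F * t) *
      (\<Prod>x\<in>?F. p * exp (- (\<theta> * \<delta> * (M - x))) + (1 - p) * exp (\<theta> * (M - x)))"
    by (rule iffD1[OF ennreal_le_iff, rotated]) (use p in \<open>auto intro!: prod_nonneg add_nonneg_nonneg mult_nonneg_nonneg\<close>)
  also have "\<dots> \<le> exp (4 * \<theta>\<^sup>2 * M * t) *
      (\<Prod>x\<in>?F. p * exp (- (\<theta> * \<delta> * (M - x))) + (1 - p) * exp (\<theta> * (M - x)))"
  proof (rule mult_right_mono)
    have "(2 * \<theta>)\<^sup>2 * card ?F * t \<le> (2 * \<theta>)\<^sup>2 * M * t"
      by (intro mult_right_mono mult_left_mono) auto
    then show "exp ((2 * \<theta>)\<^sup>2 * card ?F * t) \<le> exp (4 * \<theta>\<^sup>2 * M * t)" by (simp add: power_mult_distrib)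
  qed (use p in \<open>auto intro!: prod_nonneg add_nonneg_nonneg\<close>)
  finally show ?thesis .
qed

text \<open>Second-order expansion: the coefficient of \<open>u\<close> is minus the mean excess
  \<open>\<delta> * p - (1 - p)\<close> of cars over spots, and the quadratic terms total at most
  \<open>u\<^sup>2\<close>.\<close>

lemma site_factor_le:
  fixes u \<delta> p \<epsilon> :: real
  assumes p: "0 \<le> p" "p \<le> 1" and \<delta>: "0 \<le> \<delta>" "\<delta> \<le> 1" and u: "0 \<le> u" "u \<le> 1"
    and \<epsilon>: "\<epsilon> \<le> \<delta> * p - (1 - p)"
  shows "p * exp (- (\<delta> * u)) + (1 - p) * exp u \<le> exp (u\<^sup>2 - \<epsilon> * u)"
proof -
  have \<delta>u: "\<delta> * u \<le> u" using \<delta> u by (simp add: mult_left_le_one_le)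
  have "\<bar>- (\<delta> * u)\<bar> \<le> 1" using \<delta> u \<delta>u by (simp add: abs_mult)
  from exp_le_quadratic[OF this] have "exp (- (\<delta> * u)) \<le> 1 - \<delta> * u + (\<delta> * u)\<^sup>2" by simp
  also have "\<dots> \<le> 1 - \<delta> * u + u\<^sup>2"
    using \<delta> u \<delta>u by (intro add_left_mono power_mono) auto
  finally have "exp (- (\<delta> * u)) \<le> 1 - \<delta> * u + u\<^sup>2" .
  moreover have "exp u \<le> 1 + u + u\<^sup>2" using u by (intro exp_le_quadratic) simp
  ultimately have "p * exp (- (\<delta> * u)) + (1 - p) * exp u \<le> p * (1 - \<delta> * u + u\<^sup>2) + (1 - p) * (1 + u + u\<^sup>2)"
    using p by (intro add_mono mult_left_mono) auto
  also have "\<dots> = 1 + u\<^sup>2 - (\<delta> * p - (1 - p)) * u" by (simp add: algebra_simps)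
  also have "\<dots> \<le> 1 + u\<^sup>2 - \<epsilon> * u" using \<epsilon> u by (simp add: mult_right_mono)
  also have "\<dots> \<le> exp (u\<^sup>2 - \<epsilon> * u)" using exp_ge_add_one_self[of "u\<^sup>2 - \<epsilon> * u"] by linarith
  finally show ?thesis .
qed

lemma sum_distance: "(\<Sum>x\<in>{1..<int M}. real M - x) = real M * (real M - 1) / 2"
proof -
  have "(\<Sum>x\<in>{1..<int M}. real M - x) = (\<Sum>k\<in>{1..<M}. real k)"
    by (rule sum.reindex_bij_witness[of _ "\<lambda>k. int M - int k" "\<lambda>x. nat (int M - x)"]) auto
  also have "\<dots> = real M * (real M - 1) / 2"
    by (induction M) (auto simp: field_simps atLeastLessThanSuc Suc_le_eq)
  finally show ?thesis .
qed

text \<open>Replacing \<open>\<theta>\<close> by \<open>\<theta> / M\<close> keeps every exponent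
  \<open>?u x\<close> in the range of \<open>site_factor_le\<close>. The quadratic terms cost
  \<open>\<theta>\<^sup>2\<close> per site, and the linear gains add up to
  \<open>\<epsilon> * \<theta> * (M - 1) / 2\<close>.\<close>

lemma prob_vacant_le_exp:
  fixes \<theta> \<epsilon> p :: real and M t :: nat
  assumes p: "0 \<le> p" "p \<le> 1" and t: "1 \<le> t" "M\<^sup>2 \<le> t" and \<theta>: "0 \<le> \<theta>" "\<theta> \<le> 1"
    and M: "0 < M" and \<epsilon>: "\<epsilon> \<le> (1 - M\<^sup>2 / t) * p - (1 - p)"
  shows "measure (parking_measure p) {\<omega>. 0 \<in> vacant \<omega> t}
    \<le> exp (4 * \<theta>\<^sup>2 * t / M + \<theta>\<^sup>2 * M - \<epsilon> * \<theta> * (real M - 1) / 2)"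
proof -
  define \<delta> where "\<delta> = 1 - M\<^sup>2 / t"
  have "real (M\<^sup>2) \<le> real t" using t by (intro of_nat_mono)
  then have \<delta>: "0 \<le> \<delta>" "\<delta> \<le> 1" using t by (simp_all add: \<delta>_def)
  let ?F = "{1..<int M}" and ?u = "\<lambda>x. \<theta> / M * (real M - real_of_int x)"
  have "measure (parking_measure p) {\<omega>. 0 \<in> vacant \<omega> t} \<le> exp (4 * (\<theta> / M)\<^sup>2 * M * t) *
    (\<Prod>x\<in>?F. p * exp (- (\<theta> / M * \<delta> * (M - x))) + (1 - p) * exp (\<theta> / M * (M - x)))"
    using prob_vacant_le_prod[OF p t, of "\<theta> / M"] \<theta> by (simp add: \<delta>_def)
  also have "\<dots> \<le> exp (4 * (\<theta> / M)\<^sup>2 * M * t) * (\<Prod>x\<in>?F. exp (\<theta>\<^sup>2 - \<epsilon> * ?u x))"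
  proof (intro mult_left_mono prod_mono conjI)
    fix x assume x: "x \<in> ?F"
    then have "0 \<le> real M - x" "real M - x \<le> M" by auto
    then have "?u x \<le> \<theta> / M * M" using \<theta> by (intro mult_left_mono) auto
    then have u: "0 \<le> ?u x" "?u x \<le> \<theta>" using \<open>0 \<le> real M - x\<close> \<theta> M by auto
    have "p * exp (- (\<theta> / M * \<delta> * (M - x))) + (1 - p) * exp (\<theta> / M * (M - x))
        = p * exp (- (\<delta> * ?u x)) + (1 - p) * exp (?u x)"
      by (simp add: mult_ac)
    also have "\<dots> \<le> exp ((?u x)\<^sup>2 - \<epsilon> * ?u x)"
      using u \<theta> \<epsilon> by (intro site_factor_le p \<delta>) (auto simp: \<delta>_def)
    also have "\<dots> \<le> exp (\<theta>\<^sup>2 - \<epsilon> * ?u x)" using power_mono[OF u(2,1), of 2] by simp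
    finally show "p * exp (- (\<theta> / M * \<delta> * (M - x))) + (1 - p) * exp (\<theta> / M * (M - x))
        \<le> exp (\<theta>\<^sup>2 - \<epsilon> * ?u x)" .
  qed (use p in auto)
  also have "\<dots> = exp (4 * (\<theta> / M)\<^sup>2 * M * t + (\<Sum>x\<in>?F. \<theta>\<^sup>2 - \<epsilon> * ?u x))"
    by (simp add: exp_add exp_sum)
  also have "\<dots> \<le> exp (4 * \<theta>\<^sup>2 * t / M + \<theta>\<^sup>2 * M - \<epsilon> * \<theta> * (real M - 1) / 2)"
  proof -
    have "(\<Sum>x\<in>?F. \<theta>\<^sup>2 - \<epsilon> * ?u x) = card ?F * \<theta>\<^sup>2 - \<epsilon> * (\<theta> / M) * (\<Sum>x\<in>?F. real M - x)"
    proof -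
      have "(\<Sum>x\<in>?F. \<epsilon> * ?u x) = \<epsilon> * (\<theta> / M) * (\<Sum>x\<in>?F. real M - x)"
        by (simp only: sum_distrib_left mult.assoc)
      then show ?thesis
        using sum_subtractf[of "\<lambda>_. \<theta>\<^sup>2" "\<lambda>x. \<epsilon> * ?u x" ?F] by simp
    qed
    also have "\<dots> = real (M - 1) * \<theta>\<^sup>2 - \<epsilon> * \<theta> * (real M - 1) / 2"
      unfolding sum_distance using M by simp
    also have "\<dots> \<le> \<theta>\<^sup>2 * M - \<epsilon> * \<theta> * (real M - 1) / 2"
    proof -
      have "real (M - 1) * \<theta>\<^sup>2 \<le> real M * \<theta>\<^sup>2" by (intro mult_right_mono) auto
      then show ?thesis by (simp add: mult.commute)
    qed
    finally have "(\<Sum>x\<in>?F. \<theta>\<^sup>2 - \<epsilon> * ?u x) \<le> \<theta>\<^sup>2 * M - \<epsilon> * \<theta> * (real M - 1) / 2" .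
    moreover have "4 * (\<theta> / M)\<^sup>2 * M * t = 4 * \<theta>\<^sup>2 * t / M"
      using M by (simp add: field_simps power2_eq_square)
    ultimately show ?thesis by simp
  qed
  finally show ?thesis .
qed

text \<open>With \<open>M\<close> about \<open>\<epsilon> * sqrt t\<close>, all three terms of the
  exponent are of order \<open>M\<close>. The hypothesis on \<open>t\<close> ensures
  \<open>2 \<le> M\<close>, so rounding down and passing from \<open>M\<close> to
  \<open>M - 1\<close> each lose at most a factor 2.\<close>

lemma upper_bound_large:
  fixes \<epsilon> p :: real and t :: nat
  assumes p: "p \<le> 1" and \<epsilon>: "0 < \<epsilon>" "p = 1 / 2 + \<epsilon>" and t: "2 \<le> \<epsilon> * sqrt t"
  shows "measure (parking_measure p) {\<omega>. 0 \<in> vacant \<omega> t} \<le> exp (- (\<epsilon> ^ 5 / 2176) * sqrt t)"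
proof -
  define M where "M = nat \<lfloor>\<epsilon> * sqrt t\<rfloor>"
  \<comment> \<open>As \<open>136 = 8 * 17\<close>, the cost
    \<open>17 * \<theta>\<^sup>2 / \<epsilon>\<^sup>2\<close> per unit of \<open>M\<close> is half
    the gain \<open>\<epsilon> * \<theta> / 4\<close>. The net rate
    \<open>\<epsilon> * \<theta> / 8\<close> becomes \<open>\<epsilon> ^ 5 / 2176\<close> on
    inserting \<open>M \<ge> \<epsilon> * sqrt t / 2\<close>.\<close>
  define \<theta> where "\<theta> = \<epsilon> ^ 3 / 136"
  have M: "real M \<le> \<epsilon> * sqrt t" "\<epsilon> * sqrt t \<le> 2 * real M" "2 \<le> real M"
    using t by (simp_all add: M_def) linarith+
  have "\<epsilon> \<le> 1 / 2" using p \<epsilon> by simp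
  have "1 \<le> t" using t by (cases "t = 0") auto
  have sq: "(real M)\<^sup>2 \<le> \<epsilon>\<^sup>2 * t"
    using power_mono[OF M(1), of 2] by (simp add: power_mult_distrib)
  also have "\<dots> \<le> 1 * real t" using \<epsilon> \<open>\<epsilon> \<le> 1 / 2\<close> by (intro mult_right_mono power_le_one) auto
  finally have "M\<^sup>2 \<le> t" by (simp flip: of_nat_power)
  have \<theta>: "0 \<le> \<theta>" "\<theta> \<le> 1"
    using \<epsilon> \<open>\<epsilon> \<le> 1 / 2\<close> power_le_one[of \<epsilon> 3] by (simp_all add: \<theta>_def)
  \<comment> \<open>The full excess is \<open>2 * p - 1 = 2 * \<epsilon>\<close>; the quadratic
    correction uses up at most \<open>\<epsilon>\<close> of it.\<close>
  have "M\<^sup>2 / t * p \<le> \<epsilon>\<^sup>2 * 1"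
    using sq \<open>1 \<le> t\<close> p \<epsilon> by (intro mult_mono) (auto simp: divide_le_eq)
  also have "\<dots> \<le> \<epsilon>" using \<epsilon> \<open>\<epsilon> \<le> 1 / 2\<close> by (simp add: power2_eq_square mult_left_le_one_le)
  finally have "\<epsilon> \<le> (1 - M\<^sup>2 / t) * p - (1 - p)" using \<epsilon> by (simp add: algebra_simps)
  then have "measure (parking_measure p) {\<omega>. 0 \<in> vacant \<omega> t}
      \<le> exp (4 * \<theta>\<^sup>2 * t / M + \<theta>\<^sup>2 * M - \<epsilon> * \<theta> * (real M - 1) / 2)"
    using p \<epsilon> M \<theta> \<open>1 \<le> t\<close> \<open>M\<^sup>2 \<le> t\<close> by (intro prob_vacant_le_exp) auto
  also have "\<dots> \<le> exp (- (\<epsilon> ^ 5 / 2176) * sqrt t)"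
  proof -
    have "\<epsilon>\<^sup>2 * t \<le> 4 * M\<^sup>2"
      using power_mono[OF M(2), of 2] \<epsilon> by (simp add: power_mult_distrib)
    then have "t / M \<le> 4 * M / \<epsilon>\<^sup>2"
      using M(3) \<epsilon> by (simp add: field_simps power2_eq_square)
    then have "4 * \<theta>\<^sup>2 * (t / M) \<le> 4 * \<theta>\<^sup>2 * (4 * M / \<epsilon>\<^sup>2)" by (intro mult_left_mono) auto
    then have 1: "4 * \<theta>\<^sup>2 * t / M \<le> 16 * (\<theta>\<^sup>2 / \<epsilon>\<^sup>2 * M)" by simp
    have "\<epsilon>\<^sup>2 \<le> 1" using \<epsilon> \<open>\<epsilon> \<le> 1 / 2\<close> by (intro power_le_one) auto
    then have 2: "\<theta>\<^sup>2 * M \<le> \<theta>\<^sup>2 / \<epsilon>\<^sup>2 * M"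
      using \<epsilon> by (intro mult_right_mono) (auto simp: le_divide_eq mult_left_le)
    have "\<epsilon> * \<theta> * (M / 2) \<le> \<epsilon> * \<theta> * (real M - 1)"
      using \<epsilon> \<theta> M(3) by (intro mult_left_mono) auto
    then have 3: "\<epsilon> * \<theta> / 4 * M \<le> \<epsilon> * \<theta> * (real M - 1) / 2" by simp
    have "17 * (\<theta>\<^sup>2 / \<epsilon>\<^sup>2) = \<epsilon> * \<theta> / 8"
      using \<epsilon> by (simp add: \<theta>_def field_simps eval_nat_numeral)
    then have eq: "17 * (\<theta>\<^sup>2 / \<epsilon>\<^sup>2 * M) = \<epsilon> * \<theta> / 8 * M" by (metis mult.assoc)
    have "4 * \<theta>\<^sup>2 * t / M + \<theta>\<^sup>2 * M - \<epsilon> * \<theta> * (real M - 1) / 2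
        \<le> 17 * (\<theta>\<^sup>2 / \<epsilon>\<^sup>2 * M) - \<epsilon> * \<theta> / 4 * M"
      using 1 2 3 by linarith
    also have "\<dots> = - (\<epsilon> * \<theta> / 8 * M)" unfolding eq by simp
    also have "\<dots> \<le> - (\<epsilon> * \<theta> / 8 * (\<epsilon> * sqrt t / 2))"
      using M(2) \<epsilon> \<theta> by (intro le_imp_neg_le mult_left_mono) auto
    also have "\<dots> = - (\<epsilon> ^ 5 / 2176) * sqrt t" by (simp add: \<theta>_def eval_nat_numeral)
    finally show ?thesis by simp
  qed
  finally show ?thesis .
qed

text \<open>A vacant origin must have been a spot initially. This handles the times too small for
  \<open>upper_bound_large\<close>.\<close>

lemma upper_bound_trivial:
  assumes p: "0 \<le> p" "p \<le> 1"
  shows "measure (parking_measure p) {\<omega>. 0 \<in> vacant \<omega> t} \<le> 1 - p"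
proof -
  let ?P = "parking_measure p"
  interpret prob_space ?P by (rule prob_space_parking_measure)
  have V: "{\<omega>. 0 \<in> vacant \<omega> t} \<in> sets ?P" using pred_state(2)[where p = p and v = 0 and s = t] by (simp add: pred_def)
  have "ennreal (measure ?P {\<omega>. 0 \<in> vacant \<omega> t}) = (\<integral>\<^sup>+ \<omega>. indicator {\<omega>. 0 \<in> vacant \<omega> t} \<omega> \<partial>?P)"
    using V by (simp add: emeasure_eq_measure)
  also have "\<dots> \<le> (\<integral>\<^sup>+ \<omega>. (\<Prod>x\<in>{0}. indicator {-1} (initial \<omega> x)) \<partial>?P)"
    by (intro nn_integral_mono) (auto simp: indicator_def vacant_iff)
  also have "\<dots> = ennreal (1 - p)"
    using p by (subst nn_integral_initial_prod) auto
  finally show ?thesis using p by (subst (asm) ennreal_le_iff) auto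
qed

lemma exp_le_power:
  fixes q x :: real
  assumes q: "0 < q" "q < 1" and n: "real n \<le> x"
  shows "exp (x * ln q) \<le> q ^ n"
proof -
  have "x * ln q \<le> n * ln q" using n q by (intro mult_right_mono_neg) auto
  then have "exp (x * ln q) \<le> exp (n * ln q)" by simp
  also have "\<dots> = q ^ n" using q by (simp add: exp_of_nat_mult)
  finally show ?thesis .
qed

theorem theorem1p5:
  fixes p :: real
  assumes "1 / 2 < p" and "p < 1"
  shows "\<exists>a>0. \<exists>b>0. \<forall>t::nat. t \<ge> 1 \<longrightarrow>
           exp (- a * sqrt (real t)) \<le> \<P>(\<omega> in parking_measure p. parking_time \<omega> > enat t) \<and>
           \<P>(\<omega> in parking_measure p. parking_time \<omega> > enat t) \<le> exp (- b * sqrt (real t))"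
proof -
  define \<epsilon> where "\<epsilon> = p - 1 / 2"
  \<comment> \<open>The barrier has \<open>2 * L + 1 \<le> 24 * sqrt t + 3 \<le> 27 * sqrt t\<close>
    sites; the summand 1 absorbs the factor 1/2 of \<open>lower_bound\<close>.\<close>
  define a where "a = 1 - 27 * ln (1 - p)"
  \<comment> \<open>The second entry serves the case \<open>\<epsilon> * sqrt t < 2\<close>: there
    \<open>b * sqrt t \<le> - ln (1 - p)\<close>, so the claimed bound is at least
    \<open>1 - p\<close>.\<close>
  define b where "b = min (\<epsilon> ^ 5 / 2176) (- ln (1 - p) * \<epsilon> / 2)"
  have \<epsilon>: "0 < \<epsilon>" "p = 1 / 2 + \<epsilon>" using assms by (auto simp: \<epsilon>_def)
  have ln: "ln (1 - p) < 0" using assms by simp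
  have "0 < a" using ln by (simp add: a_def)
  have "0 < b" using ln \<epsilon> by (simp add: b_def mult_neg_pos)
  have event: "{\<omega> \<in> space (parking_measure p). parking_time \<omega> > enat t} = {\<omega>. 0 \<in> vacant \<omega> t}" for t
    by (simp add: less_parking_time_iff)
  have lower: "exp (- a * sqrt t) \<le> measure (parking_measure p) {\<omega>. 0 \<in> vacant \<omega> t}"
    if t: "1 \<le> t" for t :: nat
  proof -
    define L where "L = nat \<lceil>12 * sqrt t\<rceil>"
    have st: "1 \<le> sqrt t" using t by simp
    then have L: "12 * sqrt t \<le> L" "L \<le> 12 * sqrt t + 1"
      unfolding L_def by linarith+
    have "exp (- a * sqrt t) = exp (- sqrt t) * exp (27 * sqrt t * ln (1 - p))"
      by (simp add: a_def algebra_simps flip: exp_add)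
    also have "\<dots> \<le> (1 / 2) * (1 - p) ^ (2 * L + 1)"
    proof (rule mult_mono)
      have "2 \<le> exp (sqrt t)" using exp_ge_add_one_self[of "sqrt t"] st by linarith
      then show "exp (- sqrt t) \<le> 1 / 2" by (simp add: exp_minus inverse_eq_divide)
      show "exp (27 * sqrt t * ln (1 - p)) \<le> (1 - p) ^ (2 * L + 1)"
      proof (rule exp_le_power)
        show "real (2 * L + 1) \<le> 27 * sqrt t" using L(2) st unfolding of_nat_add of_nat_mult by linarith
      qed (use assms in auto)
    qed (use assms in auto)
    also have "\<dots> \<le> measure (parking_measure p) {\<omega>. 0 \<in> vacant \<omega> t}"
      using lower_bound[of p t L] assms t L by simp
    finally show ?thesis .
  qed
  have upper: "measure (parking_measure p) {\<omega>. 0 \<in> vacant \<omega> t} \<le> exp (- b * sqrt t)" for t :: nat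
  proof (cases "2 \<le> \<epsilon> * sqrt t")
    case True
    have "b * sqrt t \<le> \<epsilon> ^ 5 / 2176 * sqrt t" by (intro mult_right_mono) (auto simp: b_def)
    then show ?thesis
      using upper_bound_large[OF _ \<epsilon> True] assms by (auto intro: order_trans)
  next
    case False
    have "b * sqrt t \<le> - ln (1 - p) * \<epsilon> / 2 * sqrt t" by (intro mult_right_mono) (auto simp: b_def)
    also have "\<dots> = - ln (1 - p) / 2 * (\<epsilon> * sqrt t)" by simp
    also have "\<dots> \<le> - ln (1 - p) / 2 * 2" using ln False by (intro mult_left_mono) auto
    finally have "exp (ln (1 - p)) \<le> exp (- b * sqrt t)" by simp
    then show ?thesis
      using upper_bound_trivial[of p t] assms by simp
  qed
  show ?thesis
    unfolding event using \<open>0 < a\<close> \<open>0 < b\<close> lower upper by blast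
qed

end
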